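(* Let $p'\in\mathbb{N}_0$ and let real numbers $a'''_j>0$, $v_j>0$, $w_j\ge v_j+1$ ($j=1,\dots,p'$) be given, such that $a'''_j\,l\ne -v_j-l'$ for all $j=1,\dots,p'$ and $l,l'\in\mathbb{N}_0$. Then $${}_{p'}W_{p'}\left[-t\,\Big|\begin{array}{c}(v_j,a'''_j)_1^{p'}\\(w_j,a'''_j)_1^{p'}\end{array}\right]>0\qquad\text{for every }t>0.$$
   Context: $\mathbb{N}_0=\{0,1,2,\dots\}$. The notation $(x_j,X_j)_1^l$ stands for the list $(x_1,X_1),\dots,(x_l,X_l)$ (the empty list if $l=0$); lists separated by commas are concatenated. Wright generalized hypergeometric function: for $\sum_{j=1}^{q-1}B_j-\sum_{j=1}^pA_j>-1$, $${}_pW_{q-1}\left[-z\,\Big|\begin{array}{c}(\alpha_j,A_j)_1^p\\(\beta_j,B_j)_1^{q-1}\end{array}\right]=H^{1,p}_{p,q}\left[z\,\Big|\begin{array}{c}(1-\alpha_j,A_j)_1^p\\(0,1),(1-\beta_j,B_j)_1^{q-1}\end{array}\right].$$ Fox $H$-function. For $0\le n\le p$, $0\le m\le q$, $A_j,B_j>0$, $\alpha_j,\beta_j\in\mathbb{C}$ with $A_j(l+\beta_{j'})\ne B_{j'}(\alpha_j-l'-1)$ for all $1\le j\le n$, $1\le j'\le m$, $l,l'\in\mathbb{N}_0$, put $$\Xi^{m,n}_{p,q}(s)=\frac{\prod_{j=1}^m\Gamma(\beta_j+B_js)\prod_{j=1}^n\Gamma(1-\alpha_j-A_js)}{\prod_{j=m+1}^q\Gamma(1-\beta_j-B_js)\prod_{j=n+1}^p\Gamma(\alpha_j+A_js)}$$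 (empty products are $1$), and $$H^{m,n}_{p,q}\left[z\,\Big|\begin{array}{c}(\alpha_j,A_j)_1^p\\(\beta_j,B_j)_1^q\end{array}\right]=\frac{1}{2\pi i}\int_{\mathcal C}\Xi^{m,n}_{p,q}(s)\,z^{-s}\,ds .$$ Let $\chi=\sum_{j=1}^nA_j-\sum_{j=n+1}^pA_j+\sum_{j=1}^mB_j-\sum_{j=m+1}^qB_j$. When $\chi>0$ (as is the case here) and $z>0$, $\mathcal C$ is a contour going from $\gamma-i\infty$ to $\gamma+i\infty$ ($\gamma\in\mathbb{R}$), leaving all poles of $\Gamma(\beta_j+B_js)$, $1\le j\le m$, on its left and all poles of $\Gamma(1-\alpha_j-A_js)$, $1\le j\le n$, on its right; the integral converges and does not depend on the choice of such a contour. *)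

theory Defs
  imports "HOL-Complex_Analysis.Complex_Analysis"
begin

text \<open>
  Parameter lists have type \<open>(complex \<times> real) list\<close>: \<open>us\<close> is the upper row
  \<open>(\<alpha>\<^sub>j, A\<^sub>j)\<close> of length \<open>p\<close> and \<open>ls\<close> the lower row \<open>(\<beta>\<^sub>j, B\<^sub>j)\<close> of length \<open>q\<close>.
  List positions start at \<open>0\<close>, so \<open>1 \<le> j \<le> n\<close> on paper is \<open>j < n\<close> here, and \<open>n + 1 \<le> j \<le> p\<close>
  is \<open>n \<le> j < p\<close>.
\<close>

text \<open>
  The library's \<open>Gamma\<close> is \<open>0\<close> at its poles and \<open>x / 0 = 0\<close>, so the denominator below acts as a
  product of values of the entire function \<open>1 / \<Gamma>\<close>. The numerator is only ever used away from the
  poles of its factors.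
\<close>

definition fox_Xi ::
  "nat \<Rightarrow> nat \<Rightarrow> (complex \<times> real) list \<Rightarrow> (complex \<times> real) list \<Rightarrow> complex \<Rightarrow> complex" where
  "fox_Xi m n us ls s =
     ((\<Prod>j<m. Gamma (fst (ls ! j) + of_real (snd (ls ! j)) * s)) *
      (\<Prod>j<n. Gamma (1 - fst (us ! j) - of_real (snd (us ! j)) * s))) /
     ((\<Prod>j\<in>{m..<length ls}. Gamma (1 - fst (ls ! j) - of_real (snd (ls ! j)) * s)) *
      (\<Prod>j\<in>{n..<length us}. Gamma (fst (us ! j) + of_real (snd (us ! j)) * s)))"

definition fox_chi ::
  "nat \<Rightarrow> nat \<Rightarrow> (complex \<times> real) list \<Rightarrow> (complex \<times> real) list \<Rightarrow> real" where
  "fox_chi m n us ls =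
     (\<Sum>j<n. snd (us ! j)) - (\<Sum>j\<in>{n..<length us}. snd (us ! j)) +
     (\<Sum>j<m. snd (ls ! j)) - (\<Sum>j\<in>{m..<length ls}. snd (ls ! j))"

definition fox_admissible ::
  "nat \<Rightarrow> nat \<Rightarrow> (complex \<times> real) list \<Rightarrow> (complex \<times> real) list \<Rightarrow> bool" where
  "fox_admissible m n us ls \<longleftrightarrow>
     n \<le> length us \<and> m \<le> length ls \<and>
     (\<forall>(\<alpha>, A)\<in>set us. A > 0) \<and> (\<forall>(\<beta>, B)\<in>set ls. B > 0) \<and>
     (\<forall>j<n. \<forall>j'<m. \<forall>(l::nat) (l'::nat).
        of_real (snd (us ! j)) * (of_nat l + fst (ls ! j')) \<noteq>
        of_real (snd (ls ! j')) * (fst (us ! j) - of_nat l' - 1))"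

text \<open>
  A contour from \<open>\<gamma> - i\<infinity>\<close> to \<open>\<gamma> + i\<infinity>\<close>: a simple piecewise continuously differentiable curve,
  parametrised over the whole real line, that runs up the line \<open>Re s = \<gamma>\<close> outside a
  bounded part.
\<close>

definition upward_contour :: "real \<Rightarrow> (real \<Rightarrow> complex) \<Rightarrow> bool" where
  "upward_contour \<gamma> c \<longleftrightarrow>
     c piecewise_C1_differentiable_on UNIV \<and> inj c \<and>
     (\<exists>R. \<forall>t. \<bar>t\<bar> \<ge> R \<longrightarrow> c t = Complex \<gamma> t)"

text \<open>
  The complement of an upward contour has two components; as the contour runs upwards, the one on
  its left contains the far negative real axis and the one on its right the far positive real axis.
\<close>

definition left_of_contour :: "(real \<Rightarrow> complex) \<Rightarrow> complex \<Rightarrow> bool" where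
  "left_of_contour c z \<longleftrightarrow>
     (\<forall>\<^sub>F x in at_top. connected_component (- range c) z (complex_of_real (- x)))"

definition right_of_contour :: "(real \<Rightarrow> complex) \<Rightarrow> complex \<Rightarrow> bool" where
  "right_of_contour c z \<longleftrightarrow>
     (\<forall>\<^sub>F x in at_top. connected_component (- range c) z (complex_of_real x))"

definition fox_contour ::
  "nat \<Rightarrow> nat \<Rightarrow> (complex \<times> real) list \<Rightarrow> (complex \<times> real) list \<Rightarrow> (real \<Rightarrow> complex) \<Rightarrow> bool" where
  "fox_contour m n us ls c \<longleftrightarrow>
     (\<exists>\<gamma>. upward_contour \<gamma> c) \<and>
     (\<forall>j<m. \<forall>z. is_pole (\<lambda>s. Gamma (fst (ls ! j) + of_real (snd (ls ! j)) * s)) z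
        \<longrightarrow> left_of_contour c z) \<and>
     (\<forall>j<n. \<forall>z. is_pole (\<lambda>s. Gamma (1 - fst (us ! j) - of_real (snd (us ! j)) * s)) z
        \<longrightarrow> right_of_contour c z)"

text \<open>
  The Fox \<open>H\<close>-function, restricted to \<open>\<chi> > 0\<close> and real \<open>z > 0\<close>, where the contours above are the
  ones to use; it is left unspecified elsewhere. The description is proper only if the value does
  not depend on the contour. The integral over \<open>UNIV\<close> is improper at both ends independently
  (it is not a principal value).
\<close>

definition fox_H ::
  "nat \<Rightarrow> nat \<Rightarrow> (complex \<times> real) list \<Rightarrow> (complex \<times> real) list \<Rightarrow> real \<Rightarrow> complex" where
  "fox_H m n us ls z =
     (if fox_admissible m n us ls \<and> fox_chi m n us ls > 0 \<and> z > 0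
      then THE H. \<exists>c I. fox_contour m n us ls c \<and>
             ((\<lambda>t. fox_Xi m n us ls (c t) * of_real z powr (- c t) * vector_derivative c (at t))
                has_integral I) UNIV \<and>
             H = 1 / (2 * of_real pi * \<i>) * I
      else undefined)"

text \<open>
  The Wright function \<open>\<^sub>pW\<^sub>q\<^sub>-\<^sub>1\<close>, as a function of its own argument \<open>x = -z\<close>; the indices \<open>p\<close> and
  \<open>q - 1\<close> are the lengths of the two lists.
\<close>

definition wright_W ::
  "(complex \<times> real) list \<Rightarrow> (complex \<times> real) list \<Rightarrow> real \<Rightarrow> complex" where
  "wright_W us ls x =
     (if (\<Sum>(\<beta>, B)\<leftarrow>ls. B) - (\<Sum>(\<alpha>, A)\<leftarrow>us. A) > -1
      then fox_H 1 (length us) (map (\<lambda>(\<alpha>, A). (1 - \<alpha>, A)) us)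
             ((0, 1) # map (\<lambda>(\<beta>, B). (1 - \<beta>, B)) ls) (- x)
      else undefined)"

end

theory Submission
  imports Defs "HOL-Probability.Sinc_Integral" "HOL-Real_Asymp.Real_Asymp"
begin

text \<open>
  The integrand is \<open>\<Gamma>(s) t\<^sup>-\<^sup>s\<close> times a product of ratios \<open>\<Gamma>(v - a s) / \<Gamma>(w - a s)\<close>, which stay bounded
  to the left of the line \<open>Re s = \<sigma>\<close> for small \<open>\<sigma> > 0\<close>. Shifting that line to the left past the poles of
  \<open>\<Gamma>\<close> gives the value of the Wright function as
  \<open>\<Sum>\<^sub>k (-t)\<^sup>k / k! \<Prod>\<^sub>j \<Gamma>(v\<^sub>j + a\<^sub>j k) / \<Gamma>(w\<^sub>j + a\<^sub>j k)\<close>. Each ratio is the moment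
  of order \<open>a\<^sub>j k\<close> of a Beta density on \<open>[0, 1]\<close>, so the series is obtained from \<open>e\<^sup>-\<^sup>t\<close> by averaging
  over dilations \<open>t \<mapsto> t u\<^sup>a\<close>, which preserves positivity. Any other admissible contour gives the same
  value by Cauchy's theorem: closed up with the vertical line, it has winding number \<open>0\<close>
  about every pole.
\<close>

subsection \<open>Bounds for the Gamma function\<close>

text \<open>An admissible contour is arbitrary in its bounded part: it may cross the line Re s =
  \<sigma> many times, and its end line Re s = \<gamma> may lie to the right of many poles of the
  ratios. So the region between the two curves is never described. Only winding numbers are used,
  and the sides of a contour enter through paths in its complement. The description operator in
  \<open>fox_H\<close> needs one contour whose integral exists (the vertical line) and agreement of
  all others whose integral exists. Gamma decays exponentially along vertical lines, but a bound C /
  (Im s)^2 suffices: it makes the line integral absolutely convergent and lets horizontal edges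
  vanish. The estimates of Gamma come from Euler's limit formula, compared factor by factor, and
  from the functional equation. Positivity is carried through the induction as a uniform lower bound
  on [0, Y], so that averaging needs only monotonicity of the integral.\<close>

lemma Re_pos_not_nonpos_Ints: "Re z > 0 \<Longrightarrow> z \<notin> \<int>\<^sub>\<le>\<^sub>0"
  by (auto elim!: nonpos_Ints_cases)

lemma Im_nonzero_not_nonpos_Ints: "Im z \<noteq> 0 \<Longrightarrow> z \<notin> \<int>\<^sub>\<le>\<^sub>0"
  by (auto elim!: nonpos_Ints_cases)

lemma norm_pochhammer_ge:
  fixes z :: complex
  assumes "0 < x" "x \<le> Re z"
  shows "pochhammer x n \<le> norm (pochhammer z n)"
  unfolding pochhammer_prod prod_norm[symmetric]
proof (intro prod_mono conjI)
  fix i assume "i \<in> {0..<n}"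
  show "0 \<le> x + of_nat i" using assms by simp
  show "x + of_nat i \<le> norm (z + of_nat i)"
    using assms complex_Re_le_cmod[of "z + of_nat i"] by simp
qed

text \<open>Compared termwise in Euler's limit formula: the numerators have the same modulus n!
  n^(Re z), and each factor of the denominator satisfies |z + i| \<ge> Re z + i.\<close>

lemma norm_Gamma_le_Gamma_Re:
  assumes "0 < Re z"
  shows "norm (Gamma z) \<le> Gamma (Re z)"
proof (rule LIMSEQ_le)
  show "(\<lambda>n. norm (Gamma_series z n)) \<longlonglongrightarrow> norm (Gamma z)"
    by (intro tendsto_norm Gamma_series_LIMSEQ)
  show "Gamma_series (Re z) \<longlonglongrightarrow> Gamma (Re z)"
    by (rule Gamma_series_LIMSEQ)
  have "norm (Gamma_series z n) \<le> Gamma_series (Re z) n" for n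
    using norm_pochhammer_ge[OF assms order.refl, of "n+1"] pochhammer_pos[OF assms, of "n+1"]
    unfolding Gamma_series_def norm_divide norm_mult
    by (intro frac_le) (simp_all del: pochhammer_Suc)
  thus "\<exists>N. \<forall>n\<ge>N. norm (Gamma_series z n) \<le> Gamma_series (Re z) n" by blast
qed

text \<open>In the limit formulas the factorials cancel and n^(-d) times the product of (z + d + i)
  / (z + i) = 1 + d / (z + i) remains; each factor has its largest modulus at z = x. Separate bounds
  for the two functions would not be uniform on the half-plane, since \<open>rGamma\<close> grows
  along vertical lines.\<close>

lemma norm_Gamma_ratio_le:
  fixes z :: complex and x d :: real
  assumes "0 < x" "x \<le> Re z" "0 \<le> d"
  shows "norm (Gamma z * rGamma (z + of_real d)) \<le> Gamma x * rGamma (x + d)"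
proof (rule LIMSEQ_le)
  show "(\<lambda>n. norm (Gamma_series z n * rGamma_series (z + of_real d) n))
          \<longlonglongrightarrow> norm (Gamma z * rGamma (z + of_real d))"
    by (intro tendsto_intros)
  show "(\<lambda>n. Gamma_series x n * rGamma_series (x + d) n) \<longlonglongrightarrow> Gamma x * rGamma (x + d)"
    by (intro tendsto_intros)
  have factor: "norm ((z + of_real d + of_nat i) / (z + of_nat i)) \<le> (x + d + of_nat i) / (x + of_nat i)" for i
  proof -
    have le: "x + of_nat i \<le> norm (z + of_nat i)"
      using assms complex_Re_le_cmod[of "z + of_nat i"] by simp
    have pos: "0 < x + of_nat i" using assms by simp
    have ne: "z + of_nat i \<noteq> 0" using le pos by auto
    have "(z + of_real d + of_nat i) / (z + of_nat i) = 1 + of_real d / (z + of_nat i)"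
      using ne by (simp add: field_simps)
    also have "norm \<dots> \<le> 1 + d / norm (z + of_nat i)"
      using assms norm_triangle_ineq[of 1 "of_real d / (z + of_nat i)"] by (simp add: norm_divide)
    also have "\<dots> \<le> 1 + d / (x + of_nat i)"
      using assms le pos by (intro add_left_mono divide_left_mono) (auto intro!: mult_pos_pos order_less_le_trans[OF pos le])
    also have "\<dots> = (x + d + of_nat i) / (x + of_nat i)"
      using pos by (simp add: field_simps)
    finally show ?thesis .
  qed
  have "norm (Gamma_series z n * rGamma_series (z + of_real d) n) \<le> Gamma_series x n * rGamma_series (x + d) n" if "n > 0" for n
  proof -
    define L where "L = ln (real n)"
    have eq: "Gamma_series z n * rGamma_series (z + of_real d) n
        = exp (- of_real (d * L)) * (\<Prod>i=0..<Suc n. (z + of_real d + of_nat i) / (z + of_nat i))"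
      by (simp add: Gamma_series_def rGamma_series_def pochhammer_prod exp_minus exp_add ring_distribs
            prod_dividef L_def field_simps del: prod.op_ivl_Suc)
    have eqr: "Gamma_series x n * rGamma_series (x + d) n
        = exp (- (d * L)) * (\<Prod>i=0..<Suc n. (x + d + of_nat i) / (x + of_nat i))"
      by (simp add: Gamma_series_def rGamma_series_def pochhammer_prod exp_minus exp_add ring_distribs
            prod_dividef L_def field_simps del: prod.op_ivl_Suc)
    show ?thesis
      unfolding eq eqr norm_mult prod_norm[symmetric]
      by (intro mult_mono prod_mono conjI factor prod_nonneg) auto
  qed
  thus "\<exists>N. \<forall>n\<ge>N. norm (Gamma_series z n * rGamma_series (z + of_real d) n) \<le> Gamma_series x n * rGamma_series (x + d) n"
    by (intro exI[of _ 1]) auto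
qed

lemma norm_pochhammer_ge_Im: "\<bar>Im z\<bar> ^ n \<le> norm (pochhammer z n)"
proof -
  have "(\<Prod>i=0..<n. \<bar>Im z\<bar>) \<le> (\<Prod>i=0..<n. norm (z + of_nat i))"
  proof (intro prod_mono conjI)
    fix i show "\<bar>Im z\<bar> \<le> norm (z + of_nat i)" using abs_Im_le_cmod[of "z + of_nat i"] by simp
  qed auto
  thus ?thesis by (simp add: pochhammer_prod prod_norm)
qed

text \<open>Shifting by n moves the strip to Re s \<ge> 1, where Gamma is bounded by its values on a
  compact real interval. Going back divides by n factors of modulus at least |Im s| \<ge> 1, and n
  \<ge> 2 produces the square.\<close>

lemma Gamma_strip_decay:
  obtains C where "C > 0" "\<And>s. \<alpha> \<le> Re s \<Longrightarrow> Re s \<le> \<beta> \<Longrightarrow> \<bar>Im s\<bar> \<ge> 1 \<Longrightarrow> norm (Gamma s) \<le> C / (Im s)\<^sup>2"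
proof -
  obtain n :: nat where n: "n \<ge> 2" "\<alpha> + n \<ge> 1"
  proof -
    obtain n0 :: nat where "1 - \<alpha> \<le> n0" using real_arch_simple by blast
    thus ?thesis by (intro that[of "max 2 n0"]) auto
  qed
  have cont: "continuous_on {\<alpha> + n..\<beta> + n} (Gamma :: real \<Rightarrow> real)"
    using n by (intro continuous_on_Gamma) (auto elim!: nonpos_Ints_cases)
  have "bounded (Gamma ` {\<alpha> + n..\<beta> + n})"
    by (intro compact_imp_bounded compact_continuous_image cont compact_Icc)
  then obtain C where C: "C > 0" "\<And>x. x \<in> {\<alpha> + n..\<beta> + n} \<Longrightarrow> norm (Gamma x) \<le> C"
    by (auto simp: bounded_pos)
  show ?thesis
  proof (rule that[OF C(1)])
    fix s assume s: "\<alpha> \<le> Re s" "Re s \<le> \<beta>" "\<bar>Im s\<bar> \<ge> 1"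
    have ni: "s \<notin> \<int>\<^sub>\<le>\<^sub>0" using s by (intro Im_nonzero_not_nonpos_Ints) auto
    have "norm (Gamma (s + of_nat n)) \<le> Gamma (Re (s + of_nat n))"
      using n s by (intro norm_Gamma_le_Gamma_Re) auto
    also have "\<dots> \<le> C" using C(2)[of "Re (s + of_nat n)"] s by auto
    finally have 1: "norm (Gamma (s + of_nat n)) \<le> C" .
    have ge: "(Im s)\<^sup>2 \<le> norm (pochhammer s n)"
    proof -
      have "(Im s)\<^sup>2 \<le> \<bar>Im s\<bar> ^ n"
        using power_increasing[of 2 n "\<bar>Im s\<bar>"] n s by simp
      thus ?thesis using norm_pochhammer_ge_Im[of s n] by linarith
    qed
    have "norm (Gamma s) = norm (Gamma (s + of_nat n)) / norm (pochhammer s n)"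
    proof -
      have "pochhammer s n \<noteq> 0" using ge s(3) by auto
      moreover have "Gamma (s + of_nat n) = pochhammer s n * Gamma s"
        using pochhammer_Gamma[OF ni, of n] ni by (simp add: Gamma_eq_zero_iff)
      ultimately show ?thesis by (simp add: norm_mult)
    qed
    also have "\<dots> \<le> C / (Im s)\<^sup>2"
      using 1 ge s C(1) by (intro frac_le) auto
    finally show "norm (Gamma s) \<le> C / (Im s)\<^sup>2" .
  qed
qed

lemma integrable_inverse_one_plus_square: "(\<lambda>x::real. inverse (1 + x\<^sup>2)) integrable_on UNIV"
  using set_borel_integral_eq_integral(1)[OF integrable_inverse_1_plus_square]
  by (simp add: einterval_def)

subsection \<open>Independence of the contour\<close>

text \<open>A primitive on U makes the sum telescope, so the three points may be collinear, coincide
  or come in any order. This is used to slide a side of a box.\<close>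

lemma contour_integral_linepath_add_convex:
  assumes "f holomorphic_on U" "open U" "convex U" "a \<in> U" "b \<in> U" "d \<in> U"
  shows "contour_integral (linepath a b) f + contour_integral (linepath b d) f = contour_integral (linepath a d) f"
proof -
  obtain F where F: "\<And>x. x \<in> U \<Longrightarrow> (F has_field_derivative f x) (at x)"
    using holomorphic_convex_primitive'[OF assms(3,2,1)] assms(2) by (metis at_within_open)
  have "contour_integral (linepath x y) f = F y - F x" if "x \<in> U" "y \<in> U" for x y
    using contour_integral_primitive[of U F f "linepath x y"] F that closed_segment_subset[OF that assms(3)]
    by (auto intro!: contour_integral_unique simp: has_field_derivative_at_within)
  thus ?thesis using assms by simp
qed

section \<open>Contours cut off at height T and closed up by a box\<close>

definition truncated_path :: "(real \<Rightarrow> complex) \<Rightarrow> real \<Rightarrow> real \<Rightarrow> complex" where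
  "truncated_path c T = (\<lambda>x. c (2 * T * x - T))"

text \<open>The abscissa M is a parameter because the loop has two uses: M = \<sigma> compares
  \<open>c\<close> with the vertical line, and M far out on either side makes winding numbers easy
  to find.\<close>

definition closed_contour :: "(real \<Rightarrow> complex) \<Rightarrow> real \<Rightarrow> real \<Rightarrow> real \<Rightarrow> real \<Rightarrow> complex" where
  "closed_contour c \<gamma> T M = truncated_path c T +++ linepath (Complex \<gamma> T) (Complex M T) +++
     linepath (Complex M T) (Complex M (-T)) +++ linepath (Complex M (-T)) (Complex \<gamma> (-T))"

context
  fixes \<gamma> :: real and c :: "real \<Rightarrow> complex" and R :: real
  assumes pw: "c piecewise_C1_differentiable_on UNIV"
    and tail: "\<And>t. \<bar>t\<bar> \<ge> R \<Longrightarrow> c t = Complex \<gamma> t"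
begin

lemma valid_truncated_path: "T > 0 \<Longrightarrow> valid_path (truncated_path c T)"
proof -
  assume T: "T > 0"
  have "(c \<circ> (\<lambda>x. 2 * T * x - T)) piecewise_C1_differentiable_on {0..1}"
  proof (rule piecewise_C1_differentiable_compose)
    show "(\<lambda>x. 2 * T * x - T) piecewise_C1_differentiable_on {0..1}"
      by (intro C1_differentiable_imp_piecewise) auto
    show "c piecewise_C1_differentiable_on (\<lambda>x. 2 * T * x - T) ` {0..1}"
      using pw by (rule piecewise_C1_differentiable_on_subset) auto
    fix x
    have "{0..1} \<inter> (\<lambda>x. 2 * T * x - T) -` {x} \<subseteq> {(x + T) / (2 * T)}"
      using T by (auto simp: field_simps)
    thus "finite ({0..1} \<inter> (\<lambda>x. 2 * T * x - T) -` {x})" by (rule finite_subset) auto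
  qed
  thus ?thesis by (simp add: valid_path_def truncated_path_def o_def)
qed

lemma has_contour_integral_truncated_path:
  assumes T: "T > 0"
    and I: "((\<lambda>t. f (c t) * vector_derivative c (at t)) has_integral I) {-T..T}"
  shows "(f has_contour_integral I) (truncated_path c T)"
proof -
  obtain S where S: "finite S" "c C1_differentiable_on (UNIV - S)"
    using pw by (auto simp: piecewise_C1_differentiable_on_def)
  define h where "h = (\<lambda>x::real. 2 * T * x - T)"
  have "((\<lambda>x. f (c ((2*T) *\<^sub>R x + (-T))) * vector_derivative c (at ((2*T) *\<^sub>R x + (-T)))) has_integral
           (1 / \<bar>2*T\<bar> ^ DIM(real)) *\<^sub>R I) ((\<lambda>x. (1/(2*T)) *\<^sub>R x + -((1/(2*T)) *\<^sub>R (-T))) ` cbox (-T) T)"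
    using I T by (intro has_integral_affinity) auto
  also have "(\<lambda>x. (1/(2*T)) *\<^sub>R x + -((1/(2*T)) *\<^sub>R (-T))) ` cbox (-T) T = {0..1}"
    using T image_affinity_atLeastAtMost[of "1/(2*T)" "-((1/(2*T)) * (-T))" "-T" T] by (simp add: field_simps)
  finally have 1: "((\<lambda>x. f (c (h x)) * vector_derivative c (at (h x))) has_integral (1 / (2*T)) *\<^sub>R I) {0..1}"
    using T by (simp add: h_def)
  have "((\<lambda>x. (2*T) *\<^sub>R (f (c (h x)) * vector_derivative c (at (h x)))) has_integral (2*T) *\<^sub>R (1 / (2*T)) *\<^sub>R I) {0..1}"
    by (intro has_integral_cmul 1)
  hence 2: "((\<lambda>x. (2*T) *\<^sub>R (f (c (h x)) * vector_derivative c (at (h x)))) has_integral I) {0..1}"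
    using T by simp
  \<comment> \<open>The chain rule is available only off the preimages of the finitely many corners
    of \<open>c\<close>.\<close>
  have "((\<lambda>x. f (c (h x)) * vector_derivative (\<lambda>x. c (h x)) (at x)) has_integral I) {0..1}"
  proof (rule has_integral_spike_finite[OF _ _ 2])
    show "finite ((\<lambda>s. (s + T) / (2*T)) ` S)" using S by simp
    fix x assume x: "x \<in> {0..1} - (\<lambda>s. (s + T) / (2*T)) ` S"
    have "h x \<notin> S"
    proof
      assume "h x \<in> S"
      hence "(h x + T) / (2*T) \<in> (\<lambda>s. (s + T) / (2*T)) ` S" by blast
      thus False using x T by (simp add: h_def)
    qed
    hence "(c has_vector_derivative vector_derivative c (at (h x))) (at (h x))"
      using S(2) by (auto simp: C1_differentiable_on_eq vector_derivative_works)
    moreover have "(h has_vector_derivative 2*T) (at x)"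
      unfolding h_def by (auto intro!: derivative_eq_intros)
    ultimately have "((c \<circ> h) has_vector_derivative (2*T) *\<^sub>R vector_derivative c (at (h x))) (at x)"
      by (intro vector_diff_chain_at)
    hence "vector_derivative (\<lambda>x. c (h x)) (at x) = (2*T) *\<^sub>R vector_derivative c (at (h x))"
      by (intro vector_derivative_at) (simp add: o_def)
    thus "f (c (h x)) * vector_derivative (\<lambda>x. c (h x)) (at x) =
       (2*T) *\<^sub>R (f (c (h x)) * vector_derivative c (at (h x)))" by simp
  qed
  thus ?thesis by (simp add: has_contour_integral truncated_path_def h_def)
qed

lemma truncated_path_ends:
  assumes "T > 0" "T \<ge> R"
  shows "pathstart (truncated_path c T) = Complex \<gamma> (-T)" "pathfinish (truncated_path c T) = Complex \<gamma> T"
  using assms tail[of T] tail[of "-T"] by (auto simp: truncated_path_def pathstart_def pathfinish_def)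

lemma closed_contour_loop:
  assumes "T > 0" "T \<ge> R"
  shows "valid_path (closed_contour c \<gamma> T M)"
    "pathfinish (closed_contour c \<gamma> T M) = pathstart (closed_contour c \<gamma> T M)"
  using assms valid_truncated_path truncated_path_ends
  by (auto simp: closed_contour_def)

lemma path_image_closed_contour:
  assumes "T > 0" "T \<ge> R"
  shows "path_image (closed_contour c \<gamma> T M) = path_image (truncated_path c T) \<union>
     closed_segment (Complex \<gamma> T) (Complex M T) \<union> closed_segment (Complex M T) (Complex M (-T)) \<union>
     closed_segment (Complex M (-T)) (Complex \<gamma> (-T))"
  using assms truncated_path_ends by (auto simp: closed_contour_def path_image_join)

lemma path_image_truncated_path: "T > 0 \<Longrightarrow> path_image (truncated_path c T) \<subseteq> range c"
  by (auto simp: path_image_def truncated_path_def)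

lemma contour_integral_closed_contour:
  assumes T: "T > 0" "T \<ge> R" and f: "f holomorphic_on S" "open S" "path_image (closed_contour c \<gamma> T M) \<subseteq> S"
  shows "contour_integral (closed_contour c \<gamma> T M) f = contour_integral (truncated_path c T) f
     + contour_integral (linepath (Complex \<gamma> T) (Complex M T)) f
     + contour_integral (linepath (Complex M T) (Complex M (-T))) f
     + contour_integral (linepath (Complex M (-T)) (Complex \<gamma> (-T))) f"
proof -
  have "f contour_integrable_on p" if "valid_path p" "path_image p \<subseteq> S" for p
    using contour_integrable_holomorphic_simple[OF f(1,2) that] .
  thus ?thesis
    unfolding closed_contour_def
    using T truncated_path_ends[OF T] valid_truncated_path[OF T(1)] f(3)[unfolded path_image_closed_contour[OF T]]
    by (simp add: contour_integrable_join)
qed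

lemma Re_contour_bounded: obtains B where "B > 0" "\<And>t. \<bar>Re (c t)\<bar> \<le> B"
proof -
  have "continuous_on UNIV c" using pw by (auto simp: piecewise_C1_differentiable_on_def)
  hence "bounded (c ` {-R..R})"
    by (intro compact_imp_bounded compact_continuous_image) (auto intro: continuous_on_subset)
  then obtain B where B: "B > 0" "\<And>t. t \<in> {-R..R} \<Longrightarrow> norm (c t) \<le> B"
    by (auto simp: bounded_pos)
  show ?thesis
  proof (rule that[of "B + \<bar>\<gamma>\<bar>"])
    fix t
    show "\<bar>Re (c t)\<bar> \<le> B + \<bar>\<gamma>\<bar>"
    proof (cases "\<bar>t\<bar> \<ge> R")
      case True thus ?thesis using tail B(1) by simp
    next
      case False
      hence "norm (c t) \<le> B" by (intro B(2)) auto
      thus ?thesis using abs_Re_le_cmod[of "c t"] by linarith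
    qed
  qed (use B in auto)
qed

text \<open>With an open complement, connected components are path components, so a point on one
  side of the contour is joined to the far real axis by an actual path.\<close>

lemma closed_range_contour: "closed (range c)"
proof -
  have cont: "continuous_on UNIV c" using pw by (auto simp: piecewise_C1_differentiable_on_def)
  have "range c = c ` {-R..R} \<union> {z. Re z = \<gamma> \<and> \<bar>Im z\<bar> \<ge> R}"
  proof (safe; (simp; fail)?)
    fix t assume "c t \<notin> c ` {-R..R}"
    hence t: "\<bar>t\<bar> \<ge> R" by (cases "t \<in> {-R..R}") (auto simp: abs_le_iff)
    show "Re (c t) = \<gamma>" "\<bar>Im (c t)\<bar> \<ge> R" using tail[OF t] t by auto
  next
    fix z assume "R \<le> \<bar>Im z\<bar>" "\<gamma> = Re z"
    hence "c (Im z) = z" using tail[of "Im z"] by simp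
    thus "z \<in> range c" by (metis rangeI)
  qed
  moreover have "closed (c ` {-R..R})"
    by (intro compact_imp_closed compact_continuous_image) (auto intro: continuous_on_subset[OF cont])
  moreover have "closed {z. Re z = \<gamma> \<and> \<bar>Im z\<bar> \<ge> R}"
    by (intro closed_Collect_conj closed_Collect_eq closed_Collect_le continuous_intros)
  ultimately show ?thesis by auto
qed

text \<open>
  The sign \<open>e\<close> is \<open>1\<close> for points on the left and \<open>-1\<close> for points on the right of the contour; the
  contour is closed up on the opposite side, far away.
\<close>

lemma winding_number_closed_contour_far:
  assumes e: "e = 1 \<or> e = -1"
    and z: "\<forall>\<^sub>F x in at_top. connected_component (- range c) z (complex_of_real (- e * x))"
  obtains m where "\<And>T M. T \<ge> m \<Longrightarrow> e * M \<ge> m \<Longrightarrow> T > 0 \<and> T \<ge> R \<and> z \<notin> path_image (closed_contour c \<gamma> T M) \<and>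
     winding_number (closed_contour c \<gamma> T M) z = 0"
proof -
  obtain B where B: "B > 0" "\<And>t. \<bar>Re (c t)\<bar> \<le> B" by (rule Re_contour_bounded) blast
  have B\<gamma>: "\<bar>\<gamma>\<bar> \<le> B" using B(2)[of "\<bar>R\<bar>"] tail[of "\<bar>R\<bar>"] by simp
  have "\<forall>\<^sub>F x in at_top. x > B \<and> connected_component (- range c) z (complex_of_real (- e * x))"
    using z eventually_gt_at_top[of B] by eventually_elim auto
  then obtain x0 where x0: "x0 > B" "connected_component (- range c) z (complex_of_real (- e * x0))"
    by (metis (mono_tags, lifting) eventually_at_top_linorder order.refl)
  have "path_component (- range c) z (complex_of_real (- e * x0))"
    using x0(2) closed_range_contour
    by (subst path_component_eq_connected_component) (auto intro!: open_imp_locally_path_connected simp: open_Compl)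
  then obtain g where g: "path g" "path_image g \<subseteq> - range c" "pathstart g = z" "pathfinish g = complex_of_real (- e * x0)"
    by (auto simp: path_component_def)
  have "bounded (path_image g)" using g(1) by (rule bounded_path_image)
  then obtain \<rho> where \<rho>: "\<rho> > 0" "\<And>w. w \<in> path_image g \<Longrightarrow> norm w \<le> \<rho>" by (auto simp: bounded_pos)
  \<comment> \<open>For T and e * M beyond \<rho>, the three added sides miss the disc around 0 that
    contains \<open>g\<close>; the contour itself misses \<open>g\<close> because \<open>g\<close>
    runs in its complement.\<close>
  define m where "m = \<rho> + \<bar>R\<bar> + 1 + B"
  show ?thesis
  proof (rule that[of m])
    fix T M assume T: "T \<ge> m" "e * M \<ge> m"
    hence T': "T > 0" "T \<ge> R" "T > \<rho>" "\<bar>M\<bar> > \<rho>" using \<rho>(1) B(1) e by (auto simp: m_def)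
    define l where "l = closed_contour c \<gamma> T M"
    have disj: "path_image g \<inter> path_image l = {}"
    proof -
      have "w \<notin> path_image l" if w: "w \<in> path_image g" for w
      proof -
        have "w \<notin> path_image (truncated_path c T)" using path_image_truncated_path[OF T'(1)] g(2) w by auto
        moreover have "\<bar>Re w\<bar> \<le> \<rho>" "\<bar>Im w\<bar> \<le> \<rho>"
          using \<rho>(2)[OF w] abs_Re_le_cmod[of w] abs_Im_le_cmod[of w] by auto
        ultimately show ?thesis
          using T' by (auto simp: l_def path_image_closed_contour closed_segment_same_Re closed_segment_same_Im)
      qed
      thus ?thesis by blast
    qed
    have zin: "z \<in> path_image g" "complex_of_real (- e * x0) \<in> path_image g"
      using g(3,4) pathstart_in_path_image[of g] pathfinish_in_path_image[of g] by auto
    have loop: "valid_path l" "pathfinish l = pathstart l" "path l"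
      using closed_contour_loop[OF T'(1,2)] by (auto simp: l_def valid_path_imp_path)
    \<comment> \<open>The winding number is constant along \<open>g\<close>, and the end point of
      \<open>g\<close> lies beyond the half-plane e * Re w \<ge> - B that contains the whole
      loop.\<close>
    have "winding_number l z = winding_number l (complex_of_real (- e * x0))"
      using loop zin g(1) disj by (intro winding_number_eq[where S = "path_image g"] connected_path_image) auto
    also have "\<dots> = 0"
    proof (rule winding_number_zero_outside[OF loop(3) _ loop(2)])
      have "{w. - B \<le> e * Re w} = {w. inner (complex_of_real e) w \<ge> - B}" by (simp add: inner_complex_def)
      thus cv: "convex {w. - B \<le> e * Re w}" by (simp add: convex_halfspace_ge)
      show "complex_of_real (- e * x0) \<notin> {w. - B \<le> e * Re w}" using e x0(1) by auto
      have "path_image (truncated_path c T) \<subseteq> {w. - B \<le> e * Re w}"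
      proof
        fix w assume "w \<in> path_image (truncated_path c T)"
        then obtain t where "w = c t" using path_image_truncated_path[OF T'(1)] by auto
        thus "w \<in> {w. - B \<le> e * Re w}" using B(2)[of t] e by auto
      qed
      moreover have "closed_segment u w \<subseteq> {w. - B \<le> e * Re w}"
        if "- B \<le> e * Re u" "- B \<le> e * Re w" for u w
        by (rule closed_segment_subset[OF _ _ cv]) (use that in auto)
      moreover have "- B \<le> e * \<gamma>" "- B \<le> e * M"
        using B\<gamma> e T(2) B(1) \<rho>(1) by (auto simp: m_def abs_le_iff)
      ultimately show "path_image l \<subseteq> {w. - B \<le> e * Re w}"
        unfolding l_def path_image_closed_contour[OF T'(1,2)] by simp
    qed
    finally show "T > 0 \<and> T \<ge> R \<and> z \<notin> path_image (closed_contour c \<gamma> T M) \<and>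
        winding_number (closed_contour c \<gamma> T M) z = 0"
      using T' disj zin unfolding l_def by blast
  qed
qed

text \<open>The side Re w = M of the far loop can be slid to Re w = \<sigma> without meeting z. In
  terms of integrals of 1 / (w - z), every piece that changes lies in one of three convex sets
  avoiding the real point z: the upper half-plane, the lower half-plane, or the half-plane beyond z
  on the side of \<sigma>.\<close>

lemma winding_number_closed_contour_near:
  assumes e: "e = 1 \<or> e = -1" and Im: "Im z = 0" and Re: "e * Re z < e * \<sigma>"
    and z: "\<forall>\<^sub>F x in at_top. connected_component (- range c) z (complex_of_real (- e * x))"
  shows "\<forall>\<^sub>F T in at_top. z \<notin> path_image (closed_contour c \<gamma> T \<sigma>) \<and> winding_number (closed_contour c \<gamma> T \<sigma>) z = 0"
proof -
  obtain m where m: "\<And>T M. T \<ge> m \<Longrightarrow> e * M \<ge> m \<Longrightarrow> T > 0 \<and> T \<ge> R \<and> z \<notin> path_image (closed_contour c \<gamma> T M) \<and>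
     winding_number (closed_contour c \<gamma> T M) z = 0"
    using winding_number_closed_contour_far[OF e z] by blast
  \<comment> \<open>Far enough for the preceding lemma, and not on the near side of \<sigma>;
    multiplying by e turns the maximum into a minimum when closing up on the left.\<close>
  define M where "M = e * max m (e * \<sigma>)"
  have eM: "e * M \<ge> m" "e * M \<ge> e * \<sigma>" using e by (auto simp: M_def)
  show ?thesis
    using eventually_ge_at_top[of m]
  proof eventually_elim
    case (elim T)
    have T: "T > 0" "T \<ge> R" "z \<notin> path_image (closed_contour c \<gamma> T M)" "winding_number (closed_contour c \<gamma> T M) z = 0"
      using m[OF elim eM(1)] by auto
    let ?f = "\<lambda>w. 1 / (w - z)"
    have notin: "z \<notin> path_image (closed_contour c \<gamma> T \<sigma>)"
      using T Im Re e unfolding path_image_closed_contour[OF T(1,2)]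
      by (auto simp: closed_segment_same_Re closed_segment_same_Im)
    have hol: "?f holomorphic_on S" if "z \<notin> S" for S
      using that by (intro holomorphic_intros) auto
    have wn: "winding_number (closed_contour c \<gamma> T N) z = 1 / (2 * pi * \<i>) *
       (contour_integral (truncated_path c T) ?f
     + contour_integral (linepath (Complex \<gamma> T) (Complex N T)) ?f
     + contour_integral (linepath (Complex N T) (Complex N (-T))) ?f
     + contour_integral (linepath (Complex N (-T)) (Complex \<gamma> (-T))) ?f)"
      if "z \<notin> path_image (closed_contour c \<gamma> T N)" for N
      using winding_number_valid_path[OF closed_contour_loop(1)[OF T(1,2)] that]
        contour_integral_closed_contour[OF T(1,2) hol[of "-{z}"], of N] that by auto
    have up: "contour_integral (linepath a b) ?f + contour_integral (linepath b d) ?f = contour_integral (linepath a d) ?f"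
      if "Im a > 0" "Im b > 0" "Im d > 0" for a b d
      using that Im by (intro contour_integral_linepath_add_convex[of _ "{w. Im w > 0}"] hol)
        (auto simp: convex_halfspace_Im_gt open_halfspace_Im_gt)
    have down: "contour_integral (linepath a b) ?f + contour_integral (linepath b d) ?f = contour_integral (linepath a d) ?f"
      if "Im a < 0" "Im b < 0" "Im d < 0" for a b d
      using that Im by (intro contour_integral_linepath_add_convex[of _ "{w. Im w < 0}"] hol)
        (auto simp: convex_halfspace_Im_lt open_halfspace_Im_lt)
    have side: "contour_integral (linepath a b) ?f + contour_integral (linepath b d) ?f = contour_integral (linepath a d) ?f"
      if "e * Re a \<ge> e * \<sigma>" "e * Re b \<ge> e * \<sigma>" "e * Re d \<ge> e * \<sigma>" for a b d
      using e
    proof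
      assume "e = 1"
      thus ?thesis using that Re by (intro contour_integral_linepath_add_convex[of _ "{w. Re w > Re z}"] hol)
        (auto simp: convex_halfspace_Re_gt open_halfspace_Re_gt)
    next
      assume "e = - 1"
      thus ?thesis using that Re by (intro contour_integral_linepath_add_convex[of _ "{w. Re w < Re z}"] hol)
        (auto simp: convex_halfspace_Re_lt open_halfspace_Re_lt)
    qed
    let ?I = "\<lambda>a b. contour_integral (linepath a b) ?f"
    \<comment> \<open>The rectangle between the abscissas \<sigma> and M is cut along the diagonal
      from the top at \<sigma> to the bottom at M; this accounts for the two uses of
      \<open>side\<close>.\<close>
    have "?I (Complex \<gamma> T) (Complex \<sigma> T) + ?I (Complex \<sigma> T) (Complex \<sigma> (-T)) + ?I (Complex \<sigma> (-T)) (Complex \<gamma> (-T)) =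
      ?I (Complex \<gamma> T) (Complex M T) + ?I (Complex M T) (Complex M (-T)) + ?I (Complex M (-T)) (Complex \<gamma> (-T))"
      using up[of "Complex \<gamma> T" "Complex \<sigma> T" "Complex M T", symmetric]
        down[of "Complex M (-T)" "Complex \<sigma> (-T)" "Complex \<gamma> (-T)", symmetric]
        side[of "Complex \<sigma> T" "Complex M T" "Complex M (-T)", symmetric]
        side[of "Complex \<sigma> T" "Complex M (-T)" "Complex \<sigma> (-T)", symmetric]
        eM T(1) by (simp add: add_ac)
    hence "winding_number (closed_contour c \<gamma> T \<sigma>) z = winding_number (closed_contour c \<gamma> T M) z"
      unfolding wn[OF notin] wn[OF T(3)] by (metis (no_types, lifting) add.assoc)
    thus ?case using notin T by simp
  qed
qed

end

section \<open>Passing to infinite height\<close>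

lemma has_integral_UNIV_imp_tendsto:
  fixes g :: "real \<Rightarrow> 'a::banach"
  assumes "(g has_integral I) UNIV"
  shows "((\<lambda>T. integral {-T..T} g) \<longlongrightarrow> I) at_top"
proof (rule tendstoI)
  fix e :: real assume "e > 0"
  then obtain B where B: "\<And>a b. ball 0 B \<subseteq> cbox a b \<Longrightarrow> norm (integral (cbox a b) g - I) < e"
    using assms unfolding has_integral_alt'[of g I UNIV] by simp blast
  show "\<forall>\<^sub>F T in at_top. dist (integral {-T..T} g) I < e"
    using eventually_ge_at_top[of B]
  proof eventually_elim
    case (elim T)
    have "ball 0 B \<subseteq> cbox (-T) T" using elim by (auto simp: dist_norm)
    from B[OF this] show ?case by (simp add: dist_norm)
  qed
qed

lemma truncated_path_vertical: "truncated_path (Complex \<sigma>) T = linepath (Complex \<sigma> (-T)) (Complex \<sigma> T)"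
  by (rule ext) (simp add: truncated_path_def linepath_def complex_eq_iff algebra_simps)

lemma vertical_line_C1: "Complex \<sigma> C1_differentiable_on UNIV"
  and vertical_line_vector_derivative: "vector_derivative (Complex \<sigma>) (at t) = \<i>"
proof -
  have d: "(Complex \<sigma> has_vector_derivative \<i>) (at t)" for t
  proof -
    have "((\<lambda>t. of_real \<sigma> + \<i> * of_real t) has_vector_derivative \<i>) (at t)"
      by (auto intro!: derivative_eq_intros simp: has_vector_derivative_def scaleR_conv_of_real mult.commute)
    moreover have "(\<lambda>t. of_real \<sigma> + \<i> * of_real t) = Complex \<sigma>" by (simp add: fun_eq_iff complex_eq_iff)
    ultimately show ?thesis by simp
  qed
  show "Complex \<sigma> C1_differentiable_on UNIV"
    unfolding C1_differentiable_on_def using d by (intro exI[of _ "\<lambda>_. \<i>"]) auto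
  show "vector_derivative (Complex \<sigma>) (at t) = \<i>" by (rule vector_derivative_at[OF d])
qed

text \<open>The vertical line is itself a contour, with tail threshold 0, so the result for
  truncated contours applies to it.\<close>

lemma has_contour_integral_vertical:
  assumes "T > 0" "((\<lambda>t. f (Complex \<sigma> t) * \<i>) has_integral I) {-T..T}"
  shows "(f has_contour_integral I) (linepath (Complex \<sigma> (-T)) (Complex \<sigma> T))"
  using has_contour_integral_truncated_path[of "Complex \<sigma>" 0 \<sigma> T f I] assms
  by (simp add: truncated_path_vertical vertical_line_vector_derivative C1_differentiable_imp_piecewise[OF vertical_line_C1])

text \<open>Length of the edge times the bound C / T^2 on it. The sign e selects the upper or the
  lower edge, and the end points may come in either order.\<close>

lemma tendsto_contour_integral_horizontal:
  assumes f: "continuous_on {s. Im s \<noteq> 0 \<and> min \<alpha> \<beta> \<le> Re s \<and> Re s \<le> max \<alpha> \<beta>} f"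
    and decay: "\<And>s. min \<alpha> \<beta> \<le> Re s \<Longrightarrow> Re s \<le> max \<alpha> \<beta> \<Longrightarrow> \<bar>Im s\<bar> \<ge> 1 \<Longrightarrow> norm (f s) \<le> C / (Im s)\<^sup>2"
    and e: "e = 1 \<or> e = -1"
  shows "((\<lambda>T. contour_integral (linepath (Complex \<alpha> (e * T)) (Complex \<beta> (e * T))) f) \<longlongrightarrow> 0) at_top"
proof (rule Lim_null_comparison)
  show "((\<lambda>T. C / T\<^sup>2 * \<bar>\<beta> - \<alpha>\<bar>) \<longlongrightarrow> 0) at_top" by real_asymp
  show "\<forall>\<^sub>F T in at_top. norm (contour_integral (linepath (Complex \<alpha> (e * T)) (Complex \<beta> (e * T))) f) \<le> C / T\<^sup>2 * \<bar>\<beta> - \<alpha>\<bar>"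
    using eventually_ge_at_top[of 1]
  proof eventually_elim
    case (elim T)
    have bd: "norm (f x) \<le> C / T\<^sup>2" if "x \<in> closed_segment (Complex \<alpha> (e * T)) (Complex \<beta> (e * T))" for x
      using that decay[of x] e elim by (auto simp: closed_segment_same_Im closed_segment_eq_real_ivl split: if_splits)
    have "0 \<le> C / T\<^sup>2" using bd[of "Complex \<alpha> (e * T)"] norm_ge_zero order.trans by blast
    moreover have "f contour_integrable_on linepath (Complex \<alpha> (e * T)) (Complex \<beta> (e * T))"
      using e elim by (intro contour_integrable_continuous_linepath continuous_on_subset[OF f])
        (auto simp: closed_segment_same_Im closed_segment_eq_real_ivl)
    ultimately have "norm (contour_integral (linepath (Complex \<alpha> (e * T)) (Complex \<beta> (e * T))) f) \<le> C / T\<^sup>2 * norm (Complex \<beta> (e * T) - Complex \<alpha> (e * T))"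
      by (intro contour_integral_bound_linepath bd)
    thus ?case by (simp add: cmod_def)
  qed
qed

text \<open>The loop made of \<open>c\<close> and the line Re s = \<sigma> has winding number 0
  about every singularity: one in \<open>L\<close> lies to the left of both curves, one in
  \<open>P\<close> to the right of both. The homology form of Cauchy's theorem gives integral 0, and
  the horizontal edges vanish as T grows.\<close>

theorem vertical_line_integral_eq_contour:
  assumes c: "upward_contour \<gamma> c"
    and f: "f holomorphic_on - (L \<union> P)" and op: "open (- (L \<union> P))"
    and real: "\<And>z. z \<in> L \<union> P \<Longrightarrow> Im z = 0"
    and fin: "\<And>B. finite {z \<in> L \<union> P. \<bar>Re z\<bar> \<le> B}"
    and L: "\<And>z. z \<in> L \<Longrightarrow> Re z < \<sigma> \<and> left_of_contour c z"
    and P: "\<And>z. z \<in> P \<Longrightarrow> Re z > \<sigma> \<and> right_of_contour c z"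
    and decay: "\<And>\<alpha> \<beta>. \<exists>C. \<forall>s. \<alpha> \<le> Re s \<longrightarrow> Re s \<le> \<beta> \<longrightarrow> \<bar>Im s\<bar> \<ge> 1 \<longrightarrow> norm (f s) \<le> C / (Im s)\<^sup>2"
    and I: "((\<lambda>t. f (c t) * vector_derivative c (at t)) has_integral I) UNIV"
    and J: "((\<lambda>t. f (Complex \<sigma> t) * \<i>) has_integral J) UNIV"
  shows "I = J"
proof -
  from c obtain R where pw: "c piecewise_C1_differentiable_on UNIV"
    and tail: "\<And>t. \<bar>t\<bar> \<ge> R \<Longrightarrow> c t = Complex \<gamma> t"
    by (auto simp: upward_contour_def)
  note [simp] = closed_contour_loop[OF pw tail] path_image_closed_contour[OF pw tail]
  obtain B where B: "B > 0" "\<And>t. \<bar>Re (c t)\<bar> \<le> B" using Re_contour_bounded[OF pw tail] by metis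
  define D where "D = B + \<bar>\<sigma>\<bar>"
  have \<gamma>D: "\<bar>\<gamma>\<bar> \<le> D" using B(2)[of "\<bar>R\<bar>"] tail[of "\<bar>R\<bar>"] by (simp add: D_def)
  have near: "\<forall>\<^sub>F T in at_top. z \<notin> path_image (closed_contour c \<gamma> T \<sigma>) \<and> winding_number (closed_contour c \<gamma> T \<sigma>) z = 0"
    if z: "z \<in> L \<union> P" for z
  proof (cases "z \<in> L")
    case True
    thus ?thesis using real[OF z] L[OF True]
      by (intro winding_number_closed_contour_near[where e = 1, OF pw tail]) (auto simp: left_of_contour_def)
  next
    case False
    thus ?thesis using real[OF z] P[of z] z
      by (intro winding_number_closed_contour_near[where e = "-1", OF pw tail]) (auto simp: right_of_contour_def)
  qed
  \<comment> \<open>The height required by \<open>near\<close> depends on z, so a common one exists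
    only for finitely many points. The singularities with |Re z| > D lie outside a convex strip
    containing the loop and need no condition on T.\<close>
  have "\<forall>\<^sub>F T in at_top. \<forall>z\<in>{z \<in> L \<union> P. \<bar>Re z\<bar> \<le> D}. z \<notin> path_image (closed_contour c \<gamma> T \<sigma>) \<and> winding_number (closed_contour c \<gamma> T \<sigma>) z = 0"
    using fin near by (intro eventually_ball_finite) auto
  hence ev: "\<forall>\<^sub>F T in at_top. contour_integral (truncated_path c T) f
     + contour_integral (linepath (Complex \<gamma> T) (Complex \<sigma> T)) f
     - contour_integral (linepath (Complex \<sigma> (-T)) (Complex \<sigma> T)) f
     + contour_integral (linepath (Complex \<sigma> (-T)) (Complex \<gamma> (-T))) f = 0"
    using eventually_ge_at_top[of "max 1 R"]
  proof eventually_elim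
    case (elim T)
    define l where "l = closed_contour c \<gamma> T \<sigma>"
    have T: "T > 0" "T \<ge> R" using elim by auto
    have lp: "valid_path l" "pathfinish l = pathstart l" unfolding l_def using T by simp_all
    have cv: "convex {w. \<bar>Re w\<bar> \<le> D}"
    proof -
      have "{w. \<bar>Re w\<bar> \<le> D} = {w. Re w \<ge> - D} \<inter> {w. Re w \<le> D}" by auto
      thus ?thesis by (simp add: convex_Int convex_halfspace_Re_ge convex_halfspace_Re_le)
    qed
    have sub: "path_image l \<subseteq> {w. \<bar>Re w\<bar> \<le> D}"
    proof -
      have "path_image (truncated_path c T) \<subseteq> {w. \<bar>Re w\<bar> \<le> D}"
      proof
        fix w assume "w \<in> path_image (truncated_path c T)"
        then obtain t where "w = c t" using path_image_truncated_path[OF pw tail T(1)] by auto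
        thus "w \<in> {w. \<bar>Re w\<bar> \<le> D}" using B(2)[of t] by (simp add: D_def)
      qed
      moreover have "closed_segment u w \<subseteq> {w. \<bar>Re w\<bar> \<le> D}" if "\<bar>Re u\<bar> \<le> D" "\<bar>Re w\<bar> \<le> D" for u w
        by (rule closed_segment_subset[OF _ _ cv]) (use that in auto)
      ultimately show ?thesis unfolding l_def using T \<gamma>D B(1) by (simp add: D_def)
    qed
    have wz: "z \<notin> path_image l \<and> winding_number l z = 0" if z: "z \<in> L \<union> P" for z
    proof (cases "\<bar>Re z\<bar> \<le> D")
      case True thus ?thesis using elim z unfolding l_def by blast
    next
      case False
      thus ?thesis using sub lp
        by (auto intro!: winding_number_zero_outside[OF _ cv] valid_path_imp_path)
    qed
    have "contour_integral l f = 0"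
      by (intro contour_integral_unique Cauchy_theorem_global[OF op f lp]) (use wz in auto)
    moreover have "path_image (closed_contour c \<gamma> T \<sigma>) \<subseteq> - (L \<union> P)" using wz l_def by auto
    moreover have "contour_integral (linepath (Complex \<sigma> T) (Complex \<sigma> (-T))) f = - contour_integral (linepath (Complex \<sigma> (-T)) (Complex \<sigma> T)) f"
    proof (rule contour_integral_reverse_linepath, rule continuous_on_subset[OF holomorphic_on_imp_continuous_on[OF f]])
      show "closed_segment (Complex \<sigma> T) (Complex \<sigma> (-T)) \<subseteq> - (L \<union> P)"
        using L P by (force simp: closed_segment_same_Re)
    qed
    ultimately show ?case
      using contour_integral_closed_contour[OF pw tail T f op] by (simp add: l_def)
  qed
  have tr: "contour_integral (truncated_path c T) f = integral {-T..T} (\<lambda>t. f (c t) * vector_derivative c (at t))" if "T > 0" for T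
    by (intro contour_integral_unique has_contour_integral_truncated_path[OF pw tail that] integrable_integral
        integrable_on_subinterval[OF has_integral_integrable[OF I]]) auto
  have vl: "contour_integral (linepath (Complex \<sigma> (-T)) (Complex \<sigma> T)) f = integral {-T..T} (\<lambda>t. f (Complex \<sigma> t) * \<i>)" if "T > 0" for T
    by (intro contour_integral_unique has_contour_integral_vertical that integrable_integral
        integrable_on_subinterval[OF has_integral_integrable[OF J]]) auto
  have lim1: "((\<lambda>T. contour_integral (truncated_path c T) f) \<longlongrightarrow> I) at_top"
    by (rule Lim_transform_eventually[OF has_integral_UNIV_imp_tendsto[OF I]])
       (use eventually_gt_at_top[of 0] in \<open>eventually_elim, simp add: tr\<close>)
  have lim2: "((\<lambda>T. contour_integral (linepath (Complex \<sigma> (-T)) (Complex \<sigma> T)) f) \<longlongrightarrow> J) at_top"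
    by (rule Lim_transform_eventually[OF has_integral_UNIV_imp_tendsto[OF J]])
       (use eventually_gt_at_top[of 0] in \<open>eventually_elim, simp add: vl\<close>)
  have f': "continuous_on {s. Im s \<noteq> 0 \<and> Q s} f" for Q
    using real by (intro continuous_on_subset[OF holomorphic_on_imp_continuous_on[OF f]]) auto
  obtain C where C: "\<And>s. min \<gamma> \<sigma> \<le> Re s \<Longrightarrow> Re s \<le> max \<gamma> \<sigma> \<Longrightarrow> \<bar>Im s\<bar> \<ge> 1 \<Longrightarrow> norm (f s) \<le> C / (Im s)\<^sup>2"
    using decay[of "min \<gamma> \<sigma>" "max \<gamma> \<sigma>"] by blast
  have lim3: "((\<lambda>T. contour_integral (linepath (Complex \<gamma> T) (Complex \<sigma> T)) f) \<longlongrightarrow> 0) at_top"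
    using tendsto_contour_integral_horizontal[where \<alpha> = \<gamma> and \<beta> = \<sigma> and C = C and e = 1, OF f' C] by simp
  have lim4: "((\<lambda>T. contour_integral (linepath (Complex \<sigma> (-T)) (Complex \<gamma> (-T))) f) \<longlongrightarrow> 0) at_top"
    using tendsto_contour_integral_horizontal[where \<alpha> = \<sigma> and \<beta> = \<gamma> and C = C and e = "-1", OF f'] C
    by (simp add: min.commute max.commute)
  have "((\<lambda>T::real. 0) \<longlongrightarrow> I + 0 - J + 0) at_top"
    by (rule Lim_transform_eventually[OF _ ev]) (intro tendsto_add tendsto_diff lim1 lim2 lim3 lim4)
  thus "I = J" by (simp add: tendsto_const_iff)
qed

subsection \<open>Shifting the line of integration\<close>

lemma absolutely_integrable_quadratic_decay:
  fixes g :: "real \<Rightarrow> complex"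
  assumes cont: "continuous_on UNIV g" and decay: "\<And>x. \<bar>x\<bar> \<ge> 1 \<Longrightarrow> norm (g x) \<le> C / x\<^sup>2"
  shows "g absolutely_integrable_on UNIV"
proof -
  have "bounded (g ` {-1..1})"
    by (intro compact_imp_bounded compact_continuous_image continuous_on_subset[OF cont]) auto
  then obtain D where D: "D > 0" "\<And>x. x \<in> {-1..1} \<Longrightarrow> norm (g x) \<le> D"
    by (auto simp: bounded_pos)
  have C: "C \<ge> 0" using order.trans[OF norm_ge_zero decay[of 1]] by simp
  \<comment> \<open>The factor 2 comes from 1 / x^2 \<le> 2 / (1 + x^2) for |x| \<ge> 1 and from 1
    \<le> 2 / (1 + x^2) for |x| \<le> 1.\<close>
  define E where "E = 2 * max C D"
  have bd: "norm (g x) \<le> E * inverse (1 + x\<^sup>2)" for x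
  proof (cases "\<bar>x\<bar> \<ge> 1")
    case True
    hence x: "x\<^sup>2 \<ge> 1" using one_le_power[of "\<bar>x\<bar>" 2] by simp
    have "norm (g x) \<le> C / x\<^sup>2" by (rule decay[OF True])
    also have "\<dots> = (2 * C) / (x\<^sup>2 + x\<^sup>2)" using x by (simp add: field_simps)
    also have "\<dots> \<le> (2 * C) / (1 + x\<^sup>2)" using x C by (intro divide_left_mono) (auto intro!: mult_pos_pos add_pos_nonneg)
    also have "\<dots> \<le> E / (1 + x\<^sup>2)" by (intro divide_right_mono) (auto simp: E_def)
    finally show ?thesis by (simp add: field_simps)
  next
    case False
    hence x: "x\<^sup>2 \<le> 1" by (simp add: abs_square_le_1)
    have "norm (g x) \<le> D" using False by (intro D(2)) auto
    also have "\<dots> = (2 * D) / 2" by simp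
    also have "\<dots> \<le> (2 * D) / (1 + x\<^sup>2)" using x D(1) by (intro divide_left_mono) (auto intro!: mult_pos_pos add_pos_nonneg)
    also have "\<dots> \<le> E / (1 + x\<^sup>2)" by (intro divide_right_mono) (auto simp: E_def)
    finally show ?thesis by (simp add: field_simps)
  qed
  show ?thesis
  proof (rule measurable_bounded_by_integrable_imp_absolutely_integrable)
    show "g \<in> borel_measurable (lebesgue_on UNIV)"
      using cont by (intro continuous_imp_measurable_on_sets_lebesgue) auto
    show "(\<lambda>x. E * inverse (1 + x\<^sup>2)) integrable_on UNIV"
      using integrable_on_cmult_left[OF integrable_inverse_one_plus_square, of E] by simp
  qed (use bd in auto)
qed

section \<open>The kernel Gamma(s) R(s) t^(-s)\<close>

lemma norm_of_real_powr_minus: "t > 0 \<Longrightarrow> norm (of_real t powr - s) = t powr - Re s" for t :: real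
  by (simp add: norm_powr_real_powr)

text \<open>Boundedness of R is asked only for |Im s| \<ge> 1, so that the strip may also contain
  poles of R on the real axis, as it can when an arbitrary contour is compared with the
  line.\<close>

lemma mellin_kernel_decay:
  fixes R :: "complex \<Rightarrow> complex"
  assumes t: "t > 0" and K: "\<And>s. Re s \<le> \<beta> \<Longrightarrow> \<bar>Im s\<bar> \<ge> 1 \<Longrightarrow> norm (R s) \<le> K"
  obtains C where "\<And>s. \<alpha> \<le> Re s \<Longrightarrow> Re s \<le> \<beta> \<Longrightarrow> \<bar>Im s\<bar> \<ge> 1 \<Longrightarrow> norm (Gamma s * R s * of_real t powr - s) \<le> C / (Im s)\<^sup>2"
proof -
  obtain C where C: "C > 0" "\<And>s. \<alpha> \<le> Re s \<Longrightarrow> Re s \<le> \<beta> \<Longrightarrow> \<bar>Im s\<bar> \<ge> 1 \<Longrightarrow> norm (Gamma s) \<le> C / (Im s)\<^sup>2"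
    using Gamma_strip_decay by metis
  \<comment> \<open>The monotonicity of t^(-x) in x changes direction at t = 1; the sum of both end
    values dominates in either case.\<close>
  define D where "D = t powr - \<alpha> + t powr - \<beta>"
  have D: "t powr - x \<le> D" if "\<alpha> \<le> x" "x \<le> \<beta>" for x
  proof (cases "t \<ge> 1")
    case True
    hence "t powr - x \<le> t powr - \<alpha>" using that by (intro powr_mono) auto
    thus ?thesis by (simp add: D_def add_increasing2)
  next
    case False
    hence "t powr - x \<le> t powr - \<beta>" using that t by (intro powr_mono') auto
    thus ?thesis by (simp add: D_def add_increasing)
  qed
  show ?thesis
  proof (rule that[of "C * K * D"])
    fix s assume s: "\<alpha> \<le> Re s" "Re s \<le> \<beta>" "\<bar>Im s\<bar> \<ge> 1"
    have "norm (Gamma s * R s * of_real t powr - s) \<le> C / (Im s)\<^sup>2 * K * D"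
      unfolding norm_mult norm_of_real_powr_minus[OF t]
      using C s K[OF s(2,3)] D[OF s(1,2)] order.trans[OF norm_ge_zero K[OF s(2,3)]]
      by (intro mult_mono) auto
    thus "norm (Gamma s * R s * of_real t powr - s) \<le> C * K * D / (Im s)\<^sup>2" by simp
  qed
qed

text \<open>No side condition is needed: at the poles both sides are \<open>0\<close>.\<close>

lemma Gamma_eq_divide_pochhammer: "Gamma z = Gamma (z + of_nat n) / pochhammer z n" for z :: complex
  using pochhammer_rGamma[of z n] by (simp add: Gamma_def divide_inverse mult.commute)

lemma holomorphic_of_real_powr_minus: "t > 0 \<Longrightarrow> (\<lambda>s. of_real t powr - s) holomorphic_on A" for t :: real
  by (auto intro!: holomorphic_intros simp: powr_def)

text \<open>On this line |Re (s + i)| = n - i - \<sigma>, which in reverse order are the factors of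
  the left-hand side. This is the gain of factorial size on the n-th shifted line.\<close>

lemma norm_pochhammer_left_of_poles:
  assumes "Re s = \<sigma> - real n" "\<sigma> < 1"
  shows "pochhammer (1 - \<sigma>) n \<le> norm (pochhammer s n)"
proof -
  have "pochhammer (1 - \<sigma>) n = (\<Prod>i=0..<n. 1 - \<sigma> + of_nat (n - Suc i))"
    unfolding pochhammer_prod using prod.nat_diff_reindex[of "\<lambda>i. 1 - \<sigma> + of_nat i" n]
    by (simp add: atLeast0LessThan)
  also have "\<dots> \<le> (\<Prod>i=0..<n. norm (s + of_nat i))"
  proof (intro prod_mono conjI)
    fix i assume i: "i \<in> {0..<n}"
    hence eq: "of_nat (n - Suc i) = real n - 1 - real i" by (simp add: of_nat_diff)
    show "0 \<le> 1 - \<sigma> + real (n - Suc i)" using assms by simp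
    show "1 - \<sigma> + real (n - Suc i) \<le> norm (s + of_nat i)"
      using abs_Re_le_cmod[of "s + of_nat i"] assms eq by simp
  qed
  finally show ?thesis by (simp add: pochhammer_prod prod_norm)
qed

text \<open>Since 0 < \<sigma> < 1, each shift of the line by 1 to the left crosses exactly one pole
  of Gamma, starting with 0. The gap up to \<mu> keeps the line inside an open half-plane where R is
  holomorphic.\<close>

locale mellin_barnes =
  fixes R :: "complex \<Rightarrow> complex" and \<sigma> \<mu> K t :: real
  assumes \<sigma>: "0 < \<sigma>" "\<sigma> < 1" "\<sigma> < \<mu>" and t: "t > 0"
    and holR: "R holomorphic_on {s. Re s < \<mu>}"
    and K: "\<And>s. Re s \<le> \<sigma> \<Longrightarrow> norm (R s) \<le> K"
begin

definition integrand :: "complex \<Rightarrow> complex" where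
  "integrand s = Gamma s * R s * of_real t powr - s"

definition line_integral :: "nat \<Rightarrow> real \<Rightarrow> complex" where
  "line_integral k T = contour_integral (linepath (Complex (\<sigma> - k) (-T)) (Complex (\<sigma> - k) T)) integrand"

text \<open>The residue of \<open>integrand\<close> at - k: Gamma contributes (-1)^k / k! and t^(-s)
  contributes t^k.\<close>

definition residue_term :: "nat \<Rightarrow> complex" where
  "residue_term k = of_real ((- t) ^ k / fact k) * R (- of_nat k)"

lemma integrand_decay:
  obtains C where "\<And>s. \<alpha> \<le> Re s \<Longrightarrow> Re s \<le> \<sigma> \<Longrightarrow> \<bar>Im s\<bar> \<ge> 1 \<Longrightarrow> norm (integrand s) \<le> C / (Im s)\<^sup>2"
  unfolding integrand_def using mellin_kernel_decay[OF t, of \<sigma> R K \<alpha>] K by blast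

lemma integrand_holomorphic: "A \<subseteq> {s. Re s < \<mu>} \<Longrightarrow> A \<inter> \<int>\<^sub>\<le>\<^sub>0 = {} \<Longrightarrow> integrand holomorphic_on A"
  unfolding integrand_def by (intro holomorphic_intros holomorphic_of_real_powr_minus t holomorphic_on_subset[OF holR]) auto

text \<open>The second claim supplies a constant for all shifted lines at once, because Gamma on
  them is expressed through its values on Re s = \<sigma>.\<close>

lemma integrable_line:
  "(\<lambda>\<tau>. integrand (Complex \<sigma> \<tau>)) absolutely_integrable_on UNIV"
  "(\<lambda>\<tau>. Gamma (Complex \<sigma> \<tau>)) absolutely_integrable_on UNIV"
proof -
  have cont: "continuous_on UNIV (\<lambda>\<tau>. Complex \<sigma> \<tau>)"
    by (intro C1_differentiable_imp_continuous_on vertical_line_C1)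
  have sub: "range (Complex \<sigma>) \<subseteq> {s. 0 < Re s \<and> Re s < \<mu>}" using \<sigma> by auto
  have disj: "{s. 0 < Re s \<and> Re s < \<mu>} \<inter> \<int>\<^sub>\<le>\<^sub>0 = {}" by (auto dest: Re_pos_not_nonpos_Ints)
  obtain C where C: "\<And>s. \<sigma> \<le> Re s \<Longrightarrow> Re s \<le> \<sigma> \<Longrightarrow> \<bar>Im s\<bar> \<ge> 1 \<Longrightarrow> norm (integrand s) \<le> C / (Im s)\<^sup>2"
    using integrand_decay by metis
  show "(\<lambda>\<tau>. integrand (Complex \<sigma> \<tau>)) absolutely_integrable_on UNIV"
  proof (rule absolutely_integrable_quadratic_decay)
    have "continuous_on {s. 0 < Re s \<and> Re s < \<mu>} integrand"
      using integrand_holomorphic[OF _ disj] by (intro holomorphic_on_imp_continuous_on) auto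
    thus "continuous_on UNIV (\<lambda>\<tau>. integrand (Complex \<sigma> \<tau>))" by (rule continuous_on_compose2[OF _ cont sub])
  qed (use C[of "Complex \<sigma> _"] in auto)
  obtain C' where C': "\<And>s. \<sigma> \<le> Re s \<Longrightarrow> Re s \<le> \<sigma> \<Longrightarrow> \<bar>Im s\<bar> \<ge> 1 \<Longrightarrow> norm (Gamma s) \<le> C' / (Im s)\<^sup>2"
    using Gamma_strip_decay by metis
  show "(\<lambda>\<tau>. Gamma (Complex \<sigma> \<tau>)) absolutely_integrable_on UNIV"
  proof (rule absolutely_integrable_quadratic_decay)
    have "continuous_on {s. 0 < Re s \<and> Re s < \<mu>} (Gamma :: complex \<Rightarrow> complex)"
      using holomorphic_Gamma[OF disj] by (rule holomorphic_on_imp_continuous_on)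
    thus "continuous_on UNIV (\<lambda>\<tau>. Gamma (Complex \<sigma> \<tau>))" by (rule continuous_on_compose2[OF _ cont sub])
  qed (use C'[of "Complex \<sigma> _"] in auto)
qed

text \<open>The pole at - k is the only one between the two lines. Cauchy's integral formula on a
  rectangle around it gives the value, and the horizontal edges vanish in the limit.\<close>

lemma line_integral_step: "((\<lambda>T. line_integral k T - line_integral (Suc k) T) \<longlongrightarrow> 2 * pi * \<i> * residue_term k) at_top"
proof -
  define U where "U = {s. - real k - 1 < Re s \<and> Re s < - real k + 1 \<and> Re s < \<mu>}"
  \<comment> \<open>This is \<open>integrand\<close> with the factor 1 / (s + k) removed; on U the
    argument of Gamma has positive real part, and the zeros of the Pochhammer symbol lie to the
    right of U.\<close>
  define h where "h = (\<lambda>s. Gamma (s + of_nat (Suc k)) / pochhammer s k * R s * of_real t powr - s)"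
  have U: "U = {s. Re s > - real k - 1} \<inter> {s. Re s < - real k + 1} \<inter> {s. Re s < \<mu>}" by (auto simp: U_def)
  have cv: "convex U"
    unfolding U by (intro convex_Int convex_halfspace_Re_gt convex_halfspace_Re_lt)
  have op: "open U"
    unfolding U by (intro open_Int open_halfspace_Re_gt open_halfspace_Re_lt)
  have poch: "pochhammer s k \<noteq> 0" if "s \<in> U" for s
  proof
    assume "pochhammer s k = 0"
    then obtain i where "i < k" "s + of_nat i = 0"
      by (auto simp: pochhammer_eq_0_iff add_eq_0_iff)
    hence "s = - of_nat i" by (simp add: eq_neg_iff_add_eq_0)
    hence "Re s = - real i" by simp
    thus False using that \<open>i < k\<close> by (simp add: U_def)
  qed
  have hol: "h holomorphic_on U"
    unfolding h_def pochhammer_prod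
    by (intro holomorphic_intros holomorphic_of_real_powr_minus t holomorphic_on_subset[OF holR])
       (use poch in \<open>auto simp: U_def pochhammer_prod intro!: Re_pos_not_nonpos_Ints\<close>)
  \<comment> \<open>This includes s = - k, where \<open>Gamma\<close> is 0 by convention and so is
    division by 0.\<close>
  have F_h: "integrand s = h s / (s - (- of_nat k))" for s
    unfolding integrand_def h_def Gamma_eq_divide_pochhammer[of s "Suc k"] pochhammer_Suc by (simp add: field_simps)
  have F_eq: "integrand = (\<lambda>s. h s / (s + of_nat k))" using F_h by (simp add: fun_eq_iff)
  have hk: "h (- of_nat k) = residue_term k"
  proof -
    have "of_real t powr (of_nat k :: complex) = of_real t ^ k" using t by (simp add: powr_nat)
    hence "h (- of_nat k) = of_real t ^ k / ((- 1) ^ k * fact k) * R (- of_nat k)"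
      by (simp add: h_def pochhammer_same)
    also have "of_real t ^ k / ((- 1) ^ k * fact k) = (- 1) ^ k * of_real t ^ k / (fact k :: complex)"
      by (cases "even k") auto
    also have "\<dots> = of_real ((- t) ^ k / fact k)" by (simp add: power_minus[of "of_real t"])
    finally show ?thesis by (simp add: residue_term_def)
  qed
  have ksigma: "- of_nat k \<in> interior U" using \<sigma> op by (simp add: interior_open U_def)
  have ev: "\<forall>\<^sub>F T in at_top. 2 * pi * \<i> * residue_term k - contour_integral (linepath (Complex (\<sigma> - k - 1) (-T)) (Complex (\<sigma> - k) (-T))) integrand
      + contour_integral (linepath (Complex (\<sigma> - k - 1) T) (Complex (\<sigma> - k) T)) integrand = line_integral k T - line_integral (Suc k) T"
    using eventually_gt_at_top[of 0]
  proof eventually_elim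
    case (elim T)
    define a1 a2 a3 a4 where "a1 = Complex (\<sigma> - k - 1) (-T)" and "a2 = Complex (\<sigma> - k) (-T)"
      and "a3 = Complex (\<sigma> - k) T" and "a4 = Complex (\<sigma> - k - 1) T"
    have rp: "rectpath a1 a3 = linepath a1 a2 +++ linepath a2 a3 +++ linepath a3 a4 +++ linepath a4 a1"
      by (simp add: rectpath_def Let_def a1_def a2_def a3_def a4_def)
    have box: "- of_nat k \<in> box a1 a3" using \<sigma> elim by (simp add: in_box_complex_iff a1_def a3_def)
    have "path_image (rectpath a1 a3) \<subseteq> U - {- of_nat k}"
      using \<sigma> elim by (subst path_image_rectpath) (auto simp: a1_def a3_def U_def)
    hence ci: "(integrand has_contour_integral 2 * pi * \<i> * residue_term k) (rectpath a1 a3)"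
      using Cauchy_integral_formula_convex_simple[OF cv hol ksigma, of "rectpath a1 a3"] winding_number_rectpath[OF box]
      by (simp add: hk F_eq)
    hence "integrand contour_integrable_on rectpath a1 a3" by (auto simp: contour_integrable_on_def)
    hence int: "integrand contour_integrable_on linepath a1 a2" "integrand contour_integrable_on linepath a2 a3"
      "integrand contour_integrable_on linepath a3 a4" "integrand contour_integrable_on linepath a4 a1"
      unfolding rp by (auto simp: contour_integrable_join)
    have "2 * pi * \<i> * residue_term k = contour_integral (linepath a1 a2) integrand + contour_integral (linepath a2 a3) integrand
       + contour_integral (linepath a3 a4) integrand + contour_integral (linepath a4 a1) integrand"
      using contour_integral_unique[OF ci] int unfolding rp by (simp add: contour_integrable_join add_ac)
    moreover have "contour_integral (linepath a3 a4) integrand = - contour_integral (linepath a4 a3) integrand"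
      "contour_integral (linepath a4 a1) integrand = - contour_integral (linepath a1 a4) integrand"
      using contour_integral_reversepath[of "linepath a4 a3" integrand] contour_integral_reversepath[of "linepath a1 a4" integrand] by simp_all
    ultimately show ?case
      by (simp add: line_integral_def a1_def a2_def a3_def a4_def algebra_simps)
  qed
  obtain C where C: "\<And>s. \<sigma> - k - 1 \<le> Re s \<Longrightarrow> Re s \<le> \<sigma> \<Longrightarrow> \<bar>Im s\<bar> \<ge> 1 \<Longrightarrow> norm (integrand s) \<le> C / (Im s)\<^sup>2"
    using integrand_decay by metis
  have cont: "continuous_on {s. Im s \<noteq> 0 \<and> min (\<sigma> - k - 1) (\<sigma> - k) \<le> Re s \<and> Re s \<le> max (\<sigma> - k - 1) (\<sigma> - k)} integrand"
    using \<sigma> by (intro holomorphic_on_imp_continuous_on integrand_holomorphic) (auto dest: Im_nonzero_not_nonpos_Ints)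
  have hor: "((\<lambda>T. contour_integral (linepath (Complex (\<sigma> - k - 1) (e * T)) (Complex (\<sigma> - k) (e * T))) integrand) \<longlongrightarrow> 0) at_top"
    if e: "e = 1 \<or> e = -1" for e
    by (rule tendsto_contour_integral_horizontal[OF cont C e]) auto
  have "((\<lambda>T. line_integral k T - line_integral (Suc k) T) \<longlongrightarrow> 2 * pi * \<i> * residue_term k - 0 + 0) at_top"
    using hor[of "-1"] hor[of 1]
    by (intro Lim_transform_eventually[OF _ ev] tendsto_add tendsto_diff tendsto_const) auto
  thus ?thesis by simp
qed

lemma line_integral_sum: "((\<lambda>T. line_integral 0 T - line_integral n T) \<longlongrightarrow> 2 * pi * \<i> * (\<Sum>k<n. residue_term k)) at_top"
proof (induction n)
  case (Suc n)
  from tendsto_add[OF Suc line_integral_step[of n]] show ?case by (simp add: algebra_simps)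
qed simp

text \<open>The functional equation carries Gamma back to Re s = \<sigma> at the price of a
  Pochhammer symbol, while |t^(-s)| = t^(n - \<sigma>). The bound does not depend on T.\<close>

lemma line_integral_bound:
  assumes "n > 0" "T > 0"
  shows "norm (line_integral n T) \<le> integral UNIV (\<lambda>\<tau>. norm (Gamma (Complex \<sigma> \<tau>))) * (K * (t powr - \<sigma> * t ^ n) / pochhammer (1 - \<sigma>) n)"
proof -
  define M where "M = K * (t powr - \<sigma> * t ^ n) / pochhammer (1 - \<sigma>) n"
  have K0: "K \<ge> 0" using K[of 0] \<sigma>(1) order.trans[OF norm_ge_zero] by auto
  have poch: "pochhammer (1 - \<sigma>) n > 0" using \<sigma> by (intro pochhammer_pos) auto
  have M: "M \<ge> 0" using K0 poch t unfolding M_def by (intro divide_nonneg_pos mult_nonneg_nonneg) auto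
  have bd: "norm (integrand (Complex (\<sigma> - n) \<tau>) * \<i>) \<le> norm (Gamma (Complex \<sigma> \<tau>)) * M" for \<tau>
  proof -
    let ?s = "Complex (\<sigma> - n) \<tau>"
    have "norm (integrand ?s * \<i>) = norm (Gamma (?s + of_nat n)) / norm (pochhammer ?s n) * norm (R ?s) * t powr - Re ?s"
      unfolding integrand_def norm_mult norm_of_real_powr_minus[OF t] by (subst Gamma_eq_divide_pochhammer[of _ n]) (simp add: norm_divide)
    also have "\<dots> \<le> norm (Gamma (?s + of_nat n)) / pochhammer (1 - \<sigma>) n * K * t powr - Re ?s"
      using \<sigma> poch K0 norm_pochhammer_left_of_poles[of ?s \<sigma> n]
      by (intro mult_mono divide_left_mono K mult_pos_pos) (auto intro: less_le_trans)
    also have "?s + of_nat n = Complex \<sigma> \<tau>" by (simp add: complex_eq_iff)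
    also have "t powr - Re ?s = t powr - \<sigma> * t ^ n"
      using t by (simp add: powr_diff powr_minus powr_realpow field_simps)
    finally show ?thesis by (simp add: M_def)
  qed
  have cont: "continuous_on {-T..T} (\<lambda>\<tau>. integrand (Complex (\<sigma> - n) \<tau>) * \<i>)"
  proof -
    have nonint: "s \<notin> \<int>\<^sub>\<le>\<^sub>0" if "Re s = \<sigma> - n" for s
    proof
      assume "s \<in> \<int>\<^sub>\<le>\<^sub>0"
      then obtain m :: int where "s = of_int m" by (auto elim!: nonpos_Ints_cases)
      hence "\<sigma> = of_int (m + int n)" using that by simp
      hence "0 < m + int n" "m + int n < 1" using \<sigma> by (metis of_int_0_less_iff, metis of_int_less_1_iff)
      thus False by simp
    qed
    have "continuous_on {s. Re s = \<sigma> - n} integrand"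
      using nonint \<sigma> by (intro holomorphic_on_imp_continuous_on integrand_holomorphic) auto
    hence "continuous_on {-T..T} (\<lambda>\<tau>. integrand (Complex (\<sigma> - n) \<tau>))"
      by (rule continuous_on_compose2)
        (auto intro: continuous_on_subset[OF C1_differentiable_imp_continuous_on[OF vertical_line_C1]])
    thus ?thesis by (intro continuous_intros)
  qed
  have absint: "(\<lambda>\<tau>. norm (Gamma (Complex \<sigma> \<tau>))) integrable_on UNIV"
    using integrable_line(2) by (rule absolutely_integrable_norm[THEN set_lebesgue_integral_eq_integral(1), unfolded o_def])
  hence absint': "(\<lambda>\<tau>. norm (Gamma (Complex \<sigma> \<tau>))) integrable_on {-T..T}"
    by (rule integrable_on_subinterval) auto
  have "line_integral n T = integral {-T..T} (\<lambda>\<tau>. integrand (Complex (\<sigma> - n) \<tau>) * \<i>)"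
    unfolding line_integral_def using assms(2) cont
    by (intro contour_integral_unique has_contour_integral_vertical integrable_integral integrable_continuous_interval)
  also have "norm \<dots> \<le> integral {-T..T} (\<lambda>\<tau>. norm (Gamma (Complex \<sigma> \<tau>)) * M)"
    by (rule integral_norm_bound_integral[OF integrable_continuous_interval[OF cont] integrable_on_mult_left[OF absint'] bd])
  also have "\<dots> = integral {-T..T} (\<lambda>\<tau>. norm (Gamma (Complex \<sigma> \<tau>))) * M" by simp
  also have "\<dots> \<le> integral UNIV (\<lambda>\<tau>. norm (Gamma (Complex \<sigma> \<tau>))) * M"
    using M by (intro mult_right_mono integral_subset_le absint absint') auto
  finally show ?thesis by (simp add: M_def)
qed

text \<open>Splitting off the first factor gives pochhammer (1 - \<sigma>) (n + 1) \<ge> (1 -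
  \<sigma>) n!, so the terms of the exponential series dominate.\<close>

lemma power_over_pochhammer_tendsto_0: "(\<lambda>n. t ^ n / pochhammer (1 - \<sigma>) n) \<longlonglongrightarrow> 0"
proof (rule LIMSEQ_imp_Suc, rule Lim_null_comparison)
  have "(\<lambda>n. t ^ n / fact n) \<longlonglongrightarrow> 0"
    using summable_LIMSEQ_zero[OF summable_exp[of t]] by (simp add: field_simps)
  thus "(\<lambda>n. t / (1 - \<sigma>) * (t ^ n / fact n)) \<longlonglongrightarrow> 0" by (rule tendsto_mult_right_zero)
  show "\<forall>\<^sub>F n in sequentially. norm (t ^ Suc n / pochhammer (1 - \<sigma>) (Suc n)) \<le> t / (1 - \<sigma>) * (t ^ n / fact n)"
  proof (intro always_eventually allI)
    fix n
    \<comment> \<open>The comparison lemma has a complex base point, hence the detour through the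
      embedded real number 2 - \<sigma>.\<close>
    have "fact n = pochhammer 1 n" by (simp add: pochhammer_fact)
    also have "\<dots> \<le> norm (pochhammer (complex_of_real (1 - \<sigma> + 1)) n)" using \<sigma> by (intro norm_pochhammer_ge) auto
    also have "\<dots> = pochhammer (1 - \<sigma> + 1) n"
      using \<sigma> pochhammer_nonneg[of "1 - \<sigma> + 1" n] unfolding pochhammer_of_real by (simp del: of_real_add of_real_diff)
    finally have "(1 - \<sigma>) * fact n \<le> pochhammer (1 - \<sigma>) (Suc n)"
      using \<sigma> by (simp add: pochhammer_rec)
    moreover have "(1 - \<sigma>) * fact n > 0" using \<sigma> by simp
    ultimately have "t ^ Suc n / pochhammer (1 - \<sigma>) (Suc n) \<le> t ^ Suc n / ((1 - \<sigma>) * fact n)"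
      using t by (intro frac_le) (simp_all del: pochhammer_Suc)
    moreover have "pochhammer (1 - \<sigma>) (Suc n) > 0" using \<sigma> by (intro pochhammer_pos) auto
    ultimately show "norm (t ^ Suc n / pochhammer (1 - \<sigma>) (Suc n)) \<le> t / (1 - \<sigma>) * (t ^ n / fact n)"
      using t by (simp del: pochhammer_Suc)
  qed
qed

text \<open>For fixed n, letting T grow bounds the n-th remainder by E n; then n grows. The shifted
  integrals need only a bound, not a limit of their own.\<close>

theorem vertical_line_integral_sums:
  assumes J: "((\<lambda>\<tau>. integrand (Complex \<sigma> \<tau>) * \<i>) has_integral J) UNIV"
  shows "residue_term sums (J / (2 * pi * \<i>))"
proof -
  define G where "G = integral UNIV (\<lambda>\<tau>. norm (Gamma (Complex \<sigma> \<tau>)))"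
  define E where "E = (\<lambda>n. G * (K * (t powr - \<sigma> * t ^ n) / pochhammer (1 - \<sigma>) n))"
  have V0: "(line_integral 0 \<longlongrightarrow> J) at_top"
  proof (rule Lim_transform_eventually[OF has_integral_UNIV_imp_tendsto[OF J]])
    show "\<forall>\<^sub>F T in at_top. integral {-T..T} (\<lambda>\<tau>. integrand (Complex \<sigma> \<tau>) * \<i>) = line_integral 0 T"
      using eventually_gt_at_top[of 0]
    proof eventually_elim
      case (elim T)
      have "contour_integral (linepath (Complex \<sigma> (-T)) (Complex \<sigma> T)) integrand = integral {-T..T} (\<lambda>\<tau>. integrand (Complex \<sigma> \<tau>) * \<i>)"
        by (intro contour_integral_unique has_contour_integral_vertical elim integrable_integral
            integrable_on_subinterval[OF has_integral_integrable[OF J]]) auto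
      thus ?case by (simp add: line_integral_def)
    qed
  qed
  have bd: "norm (J - 2 * pi * \<i> * (\<Sum>k<n. residue_term k)) \<le> E n" if "n > 0" for n
  proof (rule Lim_norm_ubound[OF _ tendsto_diff[OF V0 line_integral_sum[of n]]])
    show "\<forall>\<^sub>F T in at_top. norm (line_integral 0 T - (line_integral 0 T - line_integral n T)) \<le> E n"
      using eventually_gt_at_top[of 0] by eventually_elim (use line_integral_bound[OF that] in \<open>simp add: E_def G_def\<close>)
  qed simp
  have "E \<longlonglongrightarrow> 0"
    using tendsto_mult_right_zero[OF power_over_pochhammer_tendsto_0, of "G * K * t powr - \<sigma>"] by (simp add: E_def mult_ac)
  hence "(\<lambda>n. J - 2 * pi * \<i> * (\<Sum>k<n. residue_term k)) \<longlonglongrightarrow> 0"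
    by (rule Lim_null_comparison[rotated]) (rule eventually_mono[OF eventually_gt_at_top[of 0] bd])
  from tendsto_diff[OF tendsto_const[of J] this] have "(\<lambda>n. 2 * pi * \<i> * (\<Sum>k<n. residue_term k)) \<longlonglongrightarrow> J" by simp
  from tendsto_divide[OF this tendsto_const[of "2 * pi * \<i>"]] show ?thesis
    by (simp add: sums_def)
qed

end

subsection \<open>Positivity of the series\<close>

lemma Gamma_ratio_bounds:
  fixes v w :: real
  assumes "0 < v" "v \<le> w" "0 \<le> x"
  shows "0 \<le> Gamma (v + x) * rGamma (w + x)" "Gamma (v + x) * rGamma (w + x) \<le> Gamma v * rGamma w"
proof -
  show nonneg: "0 \<le> Gamma (v + x) * rGamma (w + x)"
    using assms Gamma_real_pos[of "v + x"] Gamma_real_pos[of "w + x"] by (simp add: rGamma_inverse_Gamma)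
  have "norm (Gamma (complex_of_real (v + x)) * rGamma (complex_of_real (v + x) + of_real (w - v))) \<le> Gamma v * rGamma (v + (w - v))"
    using assms by (intro norm_Gamma_ratio_le) auto
  also have "complex_of_real (v + x) + of_real (w - v) = complex_of_real (w + x)" by simp
  finally show "Gamma (v + x) * rGamma (w + x) \<le> Gamma v * rGamma w"
    using nonneg by (simp add: Gamma_complex_of_real rGamma_complex_of_real norm_mult abs_mult[symmetric] del: of_real_add)
qed

text \<open>Euler's Beta integral with parameters v + x and w - v. The weight is normalised by
  Gamma(w - v) alone, so its total mass is Gamma(v) / Gamma(w), the factor in the lower bounds
  below.\<close>

lemma Gamma_ratio_has_integral:
  fixes v w x :: real
  assumes "0 < v" "v < w" "0 \<le> x"
  shows "((\<lambda>u. u powr x * (u powr (v - 1) * (1 - u) powr (w - v - 1) * rGamma (w - v))) has_integral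
           Gamma (v + x) * rGamma (w + x)) {0..1}"
proof -
  have "((\<lambda>u. u powr (v + x - 1) * (1 - u) powr (w - v - 1) * rGamma (w - v)) has_integral Beta (v + x) (w - v) * rGamma (w - v)) {0..1}"
    using assms by (intro has_integral_mult_left has_integral_Beta_real) auto
  also have "Beta (v + x) (w - v) * rGamma (w - v) = Gamma (v + x) * rGamma (w + x)"
    using assms Gamma_real_pos[of "w - v"] by (simp add: Beta_def rGamma_inverse_Gamma add_ac field_simps less_imp_neq[THEN not_sym])
  also have "(\<lambda>u. u powr (v + x - 1) * (1 - u) powr (w - v - 1) * rGamma (w - v)) =
     (\<lambda>u. u powr x * (u powr (v - 1) * (1 - u) powr (w - v - 1) * rGamma (w - v)))"
  proof
    fix u :: real
    have "u powr (v + x - 1) = u powr x * u powr (v - 1)" by (subst powr_add[symmetric]) (simp add: algebra_simps)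
    thus "u powr (v + x - 1) * (1 - u) powr (w - v - 1) * rGamma (w - v) =
       u powr x * (u powr (v - 1) * (1 - u) powr (w - v - 1) * rGamma (w - v))" by simp
  qed
  finally show ?thesis .
qed

text \<open>
  Multiplying the coefficients of an exponential-type series \<open>\<phi>\<close> by a Gamma ratio averages
  \<open>\<phi> (y * u\<^sup>a)\<close> over \<open>u \<in> [0, 1]\<close> against a Beta density, so lower bounds on \<open>[0, Y]\<close> survive.
\<close>

lemma exponential_series_Gamma_ratio_ge:
  fixes m :: "nat \<Rightarrow> real" and a v w y \<delta> M :: real
  assumes a: "0 < a" and v: "0 < v" "v < w" and m: "\<And>k. \<bar>m k\<bar> \<le> M" and Y: "0 \<le> Y"
    and ge: "\<And>y. 0 \<le> y \<Longrightarrow> y \<le> Y \<Longrightarrow> \<delta> \<le> (\<Sum>k. (- y) ^ k / fact k * m k)"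
    and y: "0 \<le> y" "y \<le> Y"
  shows "\<delta> * (Gamma v * rGamma w) \<le> (\<Sum>k. (- y) ^ k / fact k * (m k * (Gamma (v + a * k) * rGamma (w + a * k))))"
proof -
  define \<omega> where "\<omega> u = u powr (v - 1) * (1 - u) powr (w - v - 1) * rGamma (w - v)" for u
  have \<omega>_nonneg: "\<omega> u \<ge> 0" for u
    using v Gamma_real_pos[of "w - v"] by (simp add: \<omega>_def rGamma_inverse_Gamma)
  have int: "((\<lambda>u. u powr x * \<omega> u) has_integral Gamma (v + x) * rGamma (w + x)) {0..1}" if "x \<ge> 0" for x
    using Gamma_ratio_has_integral[OF v that] by (simp add: \<omega>_def)
  \<comment> \<open>The power with exponent 0 equals 1 only for u \<noteq> 0, hence the exceptional
    point.\<close>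
  have int0: "(\<omega> has_integral Gamma v * rGamma w) {0..1}"
    by (rule has_integral_spike_finite[OF _ _ int[of 0], of "{0}", simplified]) auto
  have summ: "summable (\<lambda>k. (- z) ^ k / fact k * m k)" and sumb: "\<bar>\<Sum>k<n. (- z) ^ k / fact k * m k\<bar> \<le> M * exp Y"
    if z: "0 \<le> z" "z \<le> Y" for z n
  proof -
    have bd: "norm ((- z) ^ k / fact k * m k) \<le> M * (Y ^ k / fact k)" for k
    proof -
      have "norm ((- z) ^ k / fact k * m k) = (z ^ k / fact k) * \<bar>m k\<bar>" using z by (simp add: abs_mult power_abs)
      also have "\<dots> \<le> (Y ^ k / fact k) * M" using z m by (intro mult_mono divide_right_mono power_mono) auto
      finally show ?thesis by (simp add: mult.commute)
    qed
    have sY: "(\<lambda>k. M * (Y ^ k / fact k)) sums (M * exp Y)"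
      using exp_converges[of Y] by (intro sums_mult) (simp add: field_simps)
    show "summable (\<lambda>k. (- z) ^ k / fact k * m k)"
      by (rule summable_comparison_test'[OF sums_summable[OF sY] bd])
    have "\<bar>\<Sum>k<n. (- z) ^ k / fact k * m k\<bar> \<le> (\<Sum>k<n. M * (Y ^ k / fact k))"
      using bd by (intro order.trans[OF sum_abs] sum_mono) (auto simp: real_norm_def)
    also have "\<dots> \<le> M * exp Y"
      unfolding sums_unique[OF sY] using Y order.trans[OF abs_ge_zero m]
      by (intro sum_le_suminf[OF sums_summable[OF sY]]) auto
    finally show "\<bar>\<Sum>k<n. (- z) ^ k / fact k * m k\<bar> \<le> M * exp Y" .
  qed
  define \<phi> where "\<phi> z = (\<Sum>k. (- z) ^ k / fact k * m k)" for z
  define f where "f n u = (\<Sum>k<n. (- (y * u powr a)) ^ k / fact k * m k) * \<omega> u" for n u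
  define S where "S n = (\<Sum>k<n. (- y) ^ k / fact k * (m k * (Gamma (v + a * k) * rGamma (w + a * k))))" for n
  have range: "0 \<le> y * u powr a \<and> y * u powr a \<le> Y" if "u \<in> {0..1}" for u
  proof -
    have "u powr a \<le> 1 powr a" using that a by (intro powr_mono2) auto
    hence "y * u powr a \<le> y * 1" using y by (intro mult_left_mono) auto
    thus ?thesis using y by simp
  qed
  have f_int: "(f n has_integral S n) {0..1}" for n
  proof -
    have "((\<lambda>u. \<Sum>k<n. (- y) ^ k / fact k * m k * (u powr (a * k) * \<omega> u)) has_integral
       (\<Sum>k<n. (- y) ^ k / fact k * m k * (Gamma (v + a * k) * rGamma (w + a * k)))) {0..1}"
      using a by (intro has_integral_sum has_integral_mult_right int) auto
    also have "(\<Sum>k<n. (- y) ^ k / fact k * m k * (Gamma (v + a * k) * rGamma (w + a * k))) = S n"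
      by (simp add: S_def mult.assoc)
    finally show ?thesis
    \<comment> \<open>The power law used here fails at u = 0 and k = 0, where \<open>0 ^ 0\<close>
      is 1 but \<open>0 powr 0\<close> is 0.\<close>
    proof (rule has_integral_spike_finite[of "{0}", rotated 2])
      fix u :: real assume "u \<in> {0..1} - {0}"
      hence "u powr a > 0" by simp
      hence "(u powr a) ^ k = u powr (a * k)" for k using powr_realpow[of "u powr a" k] by (simp add: powr_powr)
      hence "(- (y * u powr a)) ^ k = (- y) ^ k * u powr (a * k)" for k
        by (metis mult_minus_left power_mult_distrib)
      thus "f n u = (\<Sum>k<n. (- y) ^ k / fact k * m k * (u powr (a * k) * \<omega> u))"
        by (simp add: f_def sum_distrib_right sum_distrib_left mult_ac)
    qed auto
  qed
  have lim: "(\<lambda>n. f n u) \<longlonglongrightarrow> \<phi> (y * u powr a) * \<omega> u" if "u \<in> {0..1}" for u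
    unfolding f_def \<phi>_def using range[OF that] by (intro tendsto_mult_right summable_LIMSEQ summ) auto
  have dom: "norm (f n u) \<le> M * exp Y * \<omega> u" if "u \<in> {0..1}" for n u
    unfolding f_def real_norm_def abs_mult abs_of_nonneg[OF \<omega>_nonneg] using \<omega>_nonneg[of u] range[OF that]
    by (intro mult_mono sumb) (auto simp: abs_of_nonneg intro: order.trans[OF abs_ge_zero sumb[of 0 0]] Y)
  have hint: "(\<lambda>u. M * exp Y * \<omega> u) integrable_on {0..1}"
    using has_integral_mult_right[OF int0] by blast
  \<comment> \<open>Interchanges sum and integral; the partial sums are dominated by M exp(Y) times
    the integrable weight.\<close>
  note dc = dominated_convergence[OF has_integral_integrable[OF f_int] hint dom lim]
  have S_lim: "S \<longlonglongrightarrow> integral {0..1} (\<lambda>u. \<phi> (y * u powr a) * \<omega> u)"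
    using dc(2) by (simp add: integral_unique[OF f_int])
  hence "(\<lambda>k. (- y) ^ k / fact k * (m k * (Gamma (v + a * k) * rGamma (w + a * k)))) sums integral {0..1} (\<lambda>u. \<phi> (y * u powr a) * \<omega> u)"
    by (simp only: sums_def S_def[abs_def])
  hence eq: "(\<Sum>k. (- y) ^ k / fact k * (m k * (Gamma (v + a * k) * rGamma (w + a * k)))) = integral {0..1} (\<lambda>u. \<phi> (y * u powr a) * \<omega> u)"
    by (simp add: sums_iff)
  \<comment> \<open>As u^a \<le> 1, the dilated argument stays in [0, Y], so the lower bound holds
    pointwise under the integral.\<close>
  have "\<delta> * (Gamma v * rGamma w) \<le> integral {0..1} (\<lambda>u. \<phi> (y * u powr a) * \<omega> u)"
  proof (rule has_integral_le[OF has_integral_mult_right[OF int0] integrable_integral[OF dc(1)]])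
    fix u :: real assume u: "u \<in> {0..1}"
    show "\<delta> * \<omega> u \<le> \<phi> (y * u powr a) * \<omega> u"
      using ge[of "y * u powr a"] range[OF u] \<omega>_nonneg by (intro mult_right_mono) (auto simp: \<phi>_def)
  qed
  thus ?thesis by (simp only: eq)
qed

lemma prod_Gamma_ratio_bounds:
  fixes a v w :: "nat \<Rightarrow> real"
  assumes "\<And>j. j < n \<Longrightarrow> 0 < a j" "\<And>j. j < n \<Longrightarrow> 0 < v j" "\<And>j. j < n \<Longrightarrow> v j < w j"
  shows "\<bar>\<Prod>j<n. Gamma (v j + a j * real k) * rGamma (w j + a j * real k)\<bar> \<le> (\<Prod>j<n. Gamma (v j) * rGamma (w j))"
  unfolding abs_prod
proof (intro prod_mono conjI)
  fix j assume "j \<in> {..<n}"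
  hence "0 < a j" "0 < v j" "v j < w j" using assms by auto
  thus "\<bar>Gamma (v j + a j * real k) * rGamma (w j + a j * real k)\<bar> \<le> Gamma (v j) * rGamma (w j)"
    using Gamma_ratio_bounds[of "v j" "w j" "a j * real k"] by simp
qed auto

text \<open>Induction on the number of ratios, starting from exp(- y) \<ge> exp(- Y). The bound must
  hold on all of [0, Y], because averaging uses the values at every y u^a. Each ratio multiplies
  \<delta> by the mass of its weight.\<close>

lemma exponential_series_prod_Gamma_ratio_pos:
  fixes a v w :: "nat \<Rightarrow> real"
  assumes "\<And>j. j < n \<Longrightarrow> 0 < a j" "\<And>j. j < n \<Longrightarrow> 0 < v j" "\<And>j. j < n \<Longrightarrow> v j < w j" "0 \<le> Y"
  shows "\<exists>\<delta>>0. \<forall>y. 0 \<le> y \<longrightarrow> y \<le> Y \<longrightarrow>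
           \<delta> \<le> (\<Sum>k. (- y) ^ k / fact k * (\<Prod>j<n. Gamma (v j + a j * real k) * rGamma (w j + a j * real k)))"
  using assms(1-3)
proof (induction n)
  case 0
  have "(\<Sum>k. (- y) ^ k / fact k) = exp (- y)" for y :: real
    using exp_converges[of "- y"] by (simp add: sums_iff field_simps)
  thus ?case by (intro exI[of _ "exp (- Y)"]) simp
next
  case (Suc n)
  hence "\<exists>\<delta>>0. \<forall>y. 0 \<le> y \<longrightarrow> y \<le> Y \<longrightarrow>
     \<delta> \<le> (\<Sum>k. (- y) ^ k / fact k * (\<Prod>j<n. Gamma (v j + a j * real k) * rGamma (w j + a j * real k)))"
    by simp
  then obtain \<delta> where \<delta>: "\<delta> > 0" "\<And>y. 0 \<le> y \<Longrightarrow> y \<le> Y \<Longrightarrow>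
     \<delta> \<le> (\<Sum>k. (- y) ^ k / fact k * (\<Prod>j<n. Gamma (v j + a j * real k) * rGamma (w j + a j * real k)))"
    by blast
  have n: "0 < a n" "0 < v n" "v n < w n" using Suc.prems by auto
  have "\<delta> * (Gamma (v n) * rGamma (w n)) \<le> (\<Sum>k. (- y) ^ k / fact k *
      ((\<Prod>j<n. Gamma (v j + a j * real k) * rGamma (w j + a j * real k)) * (Gamma (v n + a n * k) * rGamma (w n + a n * k))))"
    if "0 \<le> y" "y \<le> Y" for y
    using Suc.prems by (intro exponential_series_Gamma_ratio_ge[OF n prod_Gamma_ratio_bounds assms(4) \<delta>(2) that]) auto
  moreover have "\<delta> * (Gamma (v n) * rGamma (w n)) > 0"
    using \<delta>(1) n Gamma_real_pos[of "v n"] Gamma_real_pos[of "w n"] by (simp add: rGamma_inverse_Gamma)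
  ultimately show ?case by (auto intro!: exI[of _ "\<delta> * (Gamma (v n) * rGamma (w n))"])
qed

subsection \<open>The Wright function as a series\<close>

text \<open>Makes the pole conditions in \<open>fox_contour\<close> explicit. An affine map with b
  \<noteq> 0 takes the value - m at z only, so the pole of Gamma pulls back.\<close>

lemma is_pole_Gamma_affine_iff:
  fixes \<alpha> b z :: complex
  assumes "b \<noteq> 0"
  shows "is_pole (\<lambda>s. Gamma (\<alpha> + b * s)) z \<longleftrightarrow> \<alpha> + b * z \<in> \<int>\<^sub>\<le>\<^sub>0"
proof
  assume pole: "is_pole (\<lambda>s. Gamma (\<alpha> + b * s)) z"
  show "\<alpha> + b * z \<in> \<int>\<^sub>\<le>\<^sub>0"
  proof (rule ccontr)
    assume z: "\<alpha> + b * z \<notin> \<int>\<^sub>\<le>\<^sub>0"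
    have op: "open ((\<lambda>s. \<alpha> + b * s) -` (- \<int>\<^sub>\<le>\<^sub>0))"
      by (intro open_vimage continuous_intros) (auto simp: open_Compl)
    have "\<not> is_pole (\<lambda>s. Gamma (\<alpha> + b * s)) z"
      by (rule not_is_pole_holomorphic[OF op]) (use z in \<open>auto intro!: holomorphic_intros\<close>)
    thus False using pole by contradiction
  qed
next
  assume "\<alpha> + b * z \<in> \<int>\<^sub>\<le>\<^sub>0"
  then obtain m :: nat where m: "\<alpha> + b * z = - of_nat m" by (auto elim!: nonpos_Ints_cases')
  show "is_pole (\<lambda>s. Gamma (\<alpha> + b * s)) z"
  proof (rule is_pole_compose[OF is_pole_Gamma[of m]])
    have "isCont (\<lambda>s. \<alpha> + b * s) z" by (intro continuous_intros)
    thus "(\<lambda>s. \<alpha> + b * s) \<midarrow>z\<rightarrow> - of_nat m" using m by (simp add: isCont_def)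
    show "\<forall>\<^sub>F s in at z. \<alpha> + b * s \<noteq> - of_nat m"
      using assms by (auto simp: eventually_at_filter simp flip: m)
  qed
qed


section \<open>Vertical lines as contours\<close>

lemma left_of_vertical_line:
  assumes "Re z < \<sigma>"
  shows "left_of_contour (Complex \<sigma>) z"
  unfolding left_of_contour_def using eventually_gt_at_top[of "- \<sigma>"]
proof eventually_elim
  case (elim x)
  show ?case unfolding connected_component_def
    using assms elim by (intro exI[of _ "{s. Re s < \<sigma>}"]) (auto intro!: convex_connected convex_halfspace_Re_lt)
qed

lemma right_of_vertical_line:
  assumes "Re z > \<sigma>"
  shows "right_of_contour (Complex \<sigma>) z"
  unfolding right_of_contour_def using eventually_gt_at_top[of \<sigma>]
proof eventually_elim
  case (elim x)
  show ?case unfolding connected_component_def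
    using assms elim by (intro exI[of _ "{s. Re s > \<sigma>}"]) (auto intro!: convex_connected convex_halfspace_Re_gt)
qed

lemma upward_contour_vertical_line: "upward_contour \<sigma> (Complex \<sigma>)"
  by (auto simp: upward_contour_def inj_def intro: C1_differentiable_imp_piecewise vertical_line_C1)

lemma closed_if_locally_finite_Re:
  assumes "\<And>B. finite {z \<in> S. \<bar>Re z\<bar> \<le> B}"
  shows "closed S"
  unfolding closed_limpt
proof (intro allI impI)
  fix x assume "x islimpt S"
  hence "infinite (S \<inter> ball x 1)" by (simp add: islimpt_eq_infinite_ball)
  moreover have "S \<inter> ball x 1 \<subseteq> {z \<in> S. \<bar>Re z\<bar> \<le> \<bar>Re x\<bar> + 1}"
  proof safe
    fix z assume "z \<in> ball x 1"
    hence "norm (z - x) < 1" by (simp add: dist_norm norm_minus_commute)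
    thus "\<bar>Re z\<bar> \<le> \<bar>Re x\<bar> + 1" using abs_Re_le_cmod[of "z - x"] by simp
  qed
  ultimately show "x \<in> S" using assms finite_subset by blast
qed

text \<open>Covers abscissas beyond the poles of the ratio. A shift by n reaches the half-plane Re z
  \<ge> v, and each pair of Pochhammer factors costs at most 1 + d / a, because |z + i| \<ge> |Im z|
  \<ge> a.\<close>

lemma norm_Gamma_ratio_bounded:
  fixes v w a \<beta> :: real
  assumes a: "0 < a" and v: "0 < v" "v \<le> w"
  obtains K where "\<And>s. Re s \<le> \<beta> \<Longrightarrow> \<bar>Im s\<bar> \<ge> 1 \<Longrightarrow>
    norm (Gamma (of_real v - of_real a * s) * rGamma (of_real w - of_real a * s)) \<le> K"
proof -
  define d where "d = w - v"
  have d: "d \<ge> 0" using v by (simp add: d_def)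
  obtain n :: nat where n: "a * \<beta> \<le> n" using real_arch_simple by blast
  show ?thesis
  proof (rule that[of "Gamma v * rGamma (v + d) * (1 + d / a) ^ n"])
    fix s assume s: "Re s \<le> \<beta>" "\<bar>Im s\<bar> \<ge> 1"
    define z where "z = of_real v - of_real a * s"
    have "a * Re s \<le> a * \<beta>" using s a by simp
    hence Rez: "v \<le> Re (z + of_nat n)" using n by (simp add: z_def)
    have Imz: "\<bar>Im z\<bar> \<ge> a" using mult_left_mono[OF s(2), of a] a by (simp add: z_def abs_mult)
    have "norm (pochhammer (z + of_real d) n) \<le> (\<Prod>i=0..<n. (1 + d / a) * norm (z + of_nat i))"
      unfolding pochhammer_prod prod_norm[symmetric]
    proof (intro prod_mono conjI)
      fix i
      have "a \<le> norm (z + of_nat i)" using Imz abs_Im_le_cmod[of "z + of_nat i"] by simp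
      hence "d / a * a \<le> d / a * norm (z + of_nat i)" using a d by (intro mult_left_mono) auto
      hence "d \<le> d / a * norm (z + of_nat i)" using a by simp
      moreover have "norm (z + of_real d + of_nat i) \<le> norm (z + of_nat i) + d"
        using norm_triangle_ineq[of "z + of_nat i" "of_real d"] d by (simp add: add_ac)
      ultimately show "norm (z + of_real d + of_nat i) \<le> (1 + d / a) * norm (z + of_nat i)"
        by (simp add: algebra_simps)
    qed auto
    also have "\<dots> = (1 + d / a) ^ n * norm (pochhammer z n)"
      by (simp add: prod.distrib pochhammer_prod prod_norm)
    finally have poch: "norm (pochhammer (z + of_real d) n) \<le> (1 + d / a) ^ n * norm (pochhammer z n)" .
    have pz: "norm (pochhammer z n) > 0"
      using norm_pochhammer_ge_Im[of z n] Imz a zero_less_power[of "\<bar>Im z\<bar>" n] by linarith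
    have w_eq: "of_real w - of_real a * s = z + of_real d" by (simp add: z_def d_def)
    have "norm (Gamma (of_real v - of_real a * s) * rGamma (of_real w - of_real a * s)) = norm (Gamma z * rGamma (z + of_real d))"
      by (simp only: w_eq) (simp only: z_def)
    also have "\<dots> = norm (Gamma (z + of_nat n) * rGamma (z + of_nat n + of_real d)) * (norm (pochhammer (z + of_real d) n) / norm (pochhammer z n))"
      unfolding Gamma_eq_divide_pochhammer[of z n] pochhammer_rGamma[of "z + of_real d" n]
      by (simp add: norm_mult norm_divide add_ac)
    also have "\<dots> \<le> (Gamma v * rGamma (v + d)) * (1 + d / a) ^ n"
    proof (intro mult_mono norm_Gamma_ratio_le)
      show "norm (pochhammer (z + of_real d) n) / norm (pochhammer z n) \<le> (1 + d / a) ^ n"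
        using poch pz by (simp add: pos_divide_le_eq)
      show "0 \<le> Gamma v * rGamma (v + d)"
        using v d Gamma_real_pos[of v] Gamma_real_pos[of "v + d"] by (simp add: rGamma_inverse_Gamma)
    qed (use Rez v d in auto)
    finally show "norm (Gamma (of_real v - of_real a * s) * rGamma (of_real w - of_real a * s)) \<le> Gamma v * rGamma (v + d) * (1 + d / a) ^ n" .
  qed
qed

text \<open>With the entire function \<open>rGamma\<close> for the denominators, only the numerators
  can cause singularities.\<close>

definition Gamma_ratio_prod :: "nat \<Rightarrow> (nat \<Rightarrow> real) \<Rightarrow> (nat \<Rightarrow> real) \<Rightarrow> (nat \<Rightarrow> real) \<Rightarrow> complex \<Rightarrow> complex" where
  "Gamma_ratio_prod n a v w s =
     (\<Prod>j<n. Gamma (of_real (v j) - of_real (a j) * s) * rGamma (of_real (w j) - of_real (a j) * s))"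

lemma Gamma_ratio_prod_holomorphic:
  assumes "\<And>s j. s \<in> A \<Longrightarrow> j < n \<Longrightarrow> of_real (v j) - of_real (a j) * s \<notin> \<int>\<^sub>\<le>\<^sub>0"
  shows "Gamma_ratio_prod n a v w holomorphic_on A"
  unfolding Gamma_ratio_prod_def using assms by (intro holomorphic_intros) auto

lemma Gamma_ratio_prod_minus_of_nat:
  "Gamma_ratio_prod n a v w (- of_nat k) =
     of_real (\<Prod>j<n. Gamma (v j + a j * real k) * rGamma (w j + a j * real k))"
proof -
  have "of_real x - of_real y * (- of_nat k) = complex_of_real (x + y * real k)" for x y by simp
  thus ?thesis
    by (simp add: Gamma_ratio_prod_def Gamma_complex_of_real rGamma_complex_of_real del: of_real_add mult_minus_right)
qed

text \<open>Here the j-th numerator argument has real part at least v - a \<sigma> > 0, so each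
  factor is bounded by its value at s = \<sigma>.\<close>

lemma norm_Gamma_ratio_prod_le_left:
  assumes "\<And>j. j < n \<Longrightarrow> 0 \<le> a j" "\<And>j. j < n \<Longrightarrow> a j * \<sigma> < v j" "\<And>j. j < n \<Longrightarrow> v j \<le> w j" "Re s \<le> \<sigma>"
  shows "norm (Gamma_ratio_prod n a v w s) \<le> (\<Prod>j<n. Gamma (v j - a j * \<sigma>) * rGamma (w j - a j * \<sigma>))"
  unfolding Gamma_ratio_prod_def prod_norm[symmetric]
proof (intro prod_mono conjI)
  fix j assume "j \<in> {..<n}"
  hence j: "0 \<le> a j" "a j * \<sigma> < v j" "v j \<le> w j" using assms by auto
  have "a j * Re s \<le> a j * \<sigma>" using j assms(4) by (intro mult_left_mono)
  thus "norm (Gamma (of_real (v j) - of_real (a j) * s) * rGamma (of_real (w j) - of_real (a j) * s))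
      \<le> Gamma (v j - a j * \<sigma>) * rGamma (w j - a j * \<sigma>)"
    using norm_Gamma_ratio_le[of "v j - a j * \<sigma>" "of_real (v j) - of_real (a j) * s" "w j - v j"] j
    by (simp add: algebra_simps)
qed auto

lemma norm_Gamma_ratio_prod_bounded:
  assumes "\<And>j. j < n \<Longrightarrow> 0 < a j" "\<And>j. j < n \<Longrightarrow> 0 < v j" "\<And>j. j < n \<Longrightarrow> v j \<le> w j"
  shows "\<exists>K. \<forall>s. Re s \<le> \<beta> \<longrightarrow> \<bar>Im s\<bar> \<ge> 1 \<longrightarrow> norm (Gamma_ratio_prod n a v w s) \<le> K"
proof -
  have "\<exists>K. \<forall>s. Re s \<le> \<beta> \<longrightarrow> \<bar>Im s\<bar> \<ge> 1 \<longrightarrow>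
    norm (Gamma (of_real (v j) - of_real (a j) * s) * rGamma (of_real (w j) - of_real (a j) * s)) \<le> K" if "j < n" for j
    using norm_Gamma_ratio_bounded[of "a j" "v j" "w j" \<beta>] assms[OF that] by metis
  then obtain K where "\<And>j s. j < n \<Longrightarrow> Re s \<le> \<beta> \<Longrightarrow> \<bar>Im s\<bar> \<ge> 1 \<Longrightarrow>
    norm (Gamma (of_real (v j) - of_real (a j) * s) * rGamma (of_real (w j) - of_real (a j) * s)) \<le> K j" by metis
  thus ?thesis
    unfolding Gamma_ratio_prod_def prod_norm[symmetric]
    by (intro exI[of _ "\<Prod>j<n. K j"] allI impI prod_mono) auto
qed

theorem wright_W_eq_series:
  fixes a v w :: "nat \<Rightarrow> real" and n :: nat and t :: real
  assumes a: "\<And>j. j < n \<Longrightarrow> 0 < a j" and v: "\<And>j. j < n \<Longrightarrow> 0 < v j" and w: "\<And>j. j < n \<Longrightarrow> v j \<le> w j"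
    and t: "t > 0"
  shows "wright_W (map (\<lambda>j. (of_real (v j), a j)) [0..<n]) (map (\<lambda>j. (of_real (w j), a j)) [0..<n]) (- t) =
    of_real (\<Sum>k. (- t) ^ k / fact k * (\<Prod>j<n. Gamma (v j + a j * real k) * rGamma (w j + a j * real k)))"
proof -
  define us :: "(complex \<times> real) list" where "us = map (\<lambda>j. (1 - of_real (v j), a j)) [0..<n]"
  define ls :: "(complex \<times> real) list" where "ls = (0, 1) # map (\<lambda>j. (1 - of_real (w j), a j)) [0..<n]"
  have [simp]: "length us = n" "length ls = Suc n" "ls ! 0 = (0, 1)"
    "\<And>j. j < n \<Longrightarrow> us ! j = (1 - of_real (v j), a j)" "\<And>j. j < n \<Longrightarrow> ls ! Suc j = (1 - of_real (w j), a j)"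
    by (auto simp: us_def ls_def)
  have lengths: "length us = n" "length ls = Suc n" by auto
  \<comment> \<open>The leftmost pole of the ratios, capped at 1; the cap gives \<sigma> < 1 and
    covers n = 0.\<close>
  define \<mu> where "\<mu> = Min (insert 1 ((\<lambda>j. v j / a j) ` {..<n}))"
  define \<sigma> where "\<sigma> = \<mu> / 2"
  have \<mu>: "0 < \<mu>" "\<mu> \<le> 1" "\<And>j. j < n \<Longrightarrow> a j * \<mu> \<le> v j"
  proof -
    show "0 < \<mu>" "\<mu> \<le> 1" using a v by (auto simp: \<mu>_def)
    fix j assume j: "j < n"
    hence "\<mu> \<le> v j / a j" by (auto simp: \<mu>_def)
    thus "a j * \<mu> \<le> v j" using a[OF j] by (simp add: field_simps)
  qed
  have \<sigma>: "0 < \<sigma>" "\<sigma> < 1" "\<sigma> < \<mu>" using \<mu> by (auto simp: \<sigma>_def)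
  have \<sigma>v: "a j * \<sigma> < v j" if "j < n" for j
    using \<mu>(3)[OF that] mult_strict_left_mono[OF \<sigma>(3) a[OF that]] by linarith
  define R where "R = Gamma_ratio_prod n a v w"
  define K where "K = (\<Prod>j<n. Gamma (v j - a j * \<sigma>) * rGamma (w j - a j * \<sigma>))"
  interpret mellin_barnes R \<sigma> \<mu> K t
  proof
    show "R holomorphic_on {s. Re s < \<mu>}"
      unfolding R_def
    proof (intro Gamma_ratio_prod_holomorphic Re_pos_not_nonpos_Ints)
      fix s j assume s: "s \<in> {s. Re s < \<mu>}" and j: "j < n"
      have "a j * Re s < a j * \<mu>" using s a[OF j] by simp
      thus "0 < Re (of_real (v j) - of_real (a j) * s)" using \<mu>(3)[OF j] by simp
    qed
    show "norm (R s) \<le> K" if "Re s \<le> \<sigma>" for s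
      unfolding R_def K_def using a w \<sigma>v that by (intro norm_Gamma_ratio_prod_le_left) (auto intro: less_imp_le)
  qed (use \<sigma> t in auto)

  \<comment> \<open>Valid for every s, including poles: with the conventions of the total function
    \<open>Gamma\<close>, dividing by it is multiplying by \<open>rGamma\<close>. So it can be
    rewritten under the binder in \<open>fox_H\<close>.\<close>
  have Xi: "fox_Xi 1 n us ls s * of_real t powr - s = integrand s" for s
  proof -
    have w_prod: "(\<Prod>j\<in>{1..<Suc n}. Gamma (1 - fst (ls ! j) - of_real (snd (ls ! j)) * s)) = (\<Prod>j<n. Gamma (of_real (w j) - of_real (a j) * s))"
      unfolding One_nat_def prod.atLeast_Suc_lessThan_Suc_shift atLeast0LessThan
      by (intro prod.cong) auto
    have v_prod: "(\<Prod>j<n. Gamma (1 - fst (us ! j) - of_real (snd (us ! j)) * s)) = (\<Prod>j<n. Gamma (of_real (v j) - of_real (a j) * s))"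
      by (intro prod.cong) auto
    have "(\<Prod>j<n. rGamma (of_real (w j) - of_real (a j) * s)) = inverse (\<Prod>j<n. Gamma (of_real (w j) - of_real (a j) * s))"
      using prod_inversef[of "\<lambda>j. Gamma (of_real (w j) - of_real (a j) * s)" "{..<n}"]
      by (simp only: rGamma_inverse_Gamma o_def)
    hence R: "R s = (\<Prod>j<n. Gamma (of_real (v j) - of_real (a j) * s)) * inverse (\<Prod>j<n. Gamma (of_real (w j) - of_real (a j) * s))"
      by (simp only: R_def Gamma_ratio_prod_def prod.distrib)
    show ?thesis
      unfolding fox_Xi_def lengths w_prod v_prod integrand_def R by (simp add: divide_inverse)
  qed

  define L :: "complex set" where "L = \<int>\<^sub>\<le>\<^sub>0"
  define P :: "complex set" where "P = {z. \<exists>j<n. of_real (v j) - of_real (a j) * z \<in> \<int>\<^sub>\<le>\<^sub>0}"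
  have poleL: "is_pole (\<lambda>s. Gamma (fst (ls ! j) + of_real (snd (ls ! j)) * s)) z \<longleftrightarrow> z \<in> L" if "j < 1" for j z
    using that is_pole_Gamma_affine_iff[of 1 0 z] by (simp add: L_def)
  have poleP: "is_pole (\<lambda>s. Gamma (1 - fst (us ! j) - of_real (snd (us ! j)) * s)) z \<longleftrightarrow> of_real (v j) - of_real (a j) * z \<in> \<int>\<^sub>\<le>\<^sub>0"
    if "j < n" for j z
    using that is_pole_Gamma_affine_iff[of "- of_real (a j)" "of_real (v j)" z] a[OF that] by simp
  have contour: "fox_contour 1 n us ls c \<longleftrightarrow> (\<exists>\<gamma>. upward_contour \<gamma> c) \<and> (\<forall>z\<in>L. left_of_contour c z) \<and> (\<forall>z\<in>P. right_of_contour c z)" for c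
    unfolding fox_contour_def using poleL poleP by (auto simp: P_def)

  have P_cases: "\<exists>j k. j < n \<and> z = of_real ((v j + real k) / a j)" if "z \<in> P" for z
  proof -
    from that obtain j k where j: "j < n" and "of_real (v j) - of_real (a j) * z = - of_nat k"
      by (auto simp: P_def elim!: nonpos_Ints_cases')
    hence "of_real (a j) * z = of_real (v j) + of_nat k" by (simp add: algebra_simps)
    hence "z = (of_real (v j) + of_nat k) / of_real (a j)" using a[OF j] by (simp add: field_simps)
    hence "z = of_real ((v j + real k) / a j)" by simp
    thus ?thesis using j by blast
  qed
  have ReP: "\<sigma> < Re z" "Im z = 0" if z: "z \<in> P" for z
  proof -
    from P_cases[OF z] obtain j k where j: "j < n" and z': "z = of_real ((v j + real k) / a j)" by blast
    show "Im z = 0" by (simp only: z' Im_complex_of_real)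
    have "\<sigma> < (v j + real k) / a j" using \<sigma>v[OF j] a[OF j] by (simp add: field_simps)
    thus "\<sigma> < Re z" by (simp only: z' Re_complex_of_real)
  qed
  have ReL: "Re z < \<sigma>" "Im z = 0" if "z \<in> L" for z
    using that \<sigma> by (auto simp: L_def elim!: nonpos_Ints_cases')
  have fin: "finite {z \<in> L \<union> P. \<bar>Re z\<bar> \<le> B}" for B
  proof -
    obtain N :: nat where N: "B \<le> N" using real_arch_simple by blast
    have "\<exists>M :: nat. a j * B - v j \<le> M" for j using real_arch_simple by blast
    then obtain M :: "nat \<Rightarrow> nat" where M: "\<And>j. a j * B - v j \<le> M j" by metis
    have "z \<in> (\<lambda>k. - of_nat k) ` {..N} \<union> (\<Union>j<n. (\<lambda>k. of_real ((v j + real k) / a j)) ` {..M j})"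
      if z: "z \<in> L \<union> P" and B: "\<bar>Re z\<bar> \<le> B" for z
    proof (cases "z \<in> L")
      case True
      then obtain k where k: "z = - of_nat k" by (auto simp: L_def elim!: nonpos_Ints_cases')
      hence "k \<le> N" using B N by simp
      thus ?thesis using k by blast
    next
      case False
      hence "z \<in> P" using z by blast
      then obtain j k where j: "j < n" and z': "z = of_real ((v j + real k) / a j)" using P_cases by blast
      have "(v j + real k) / a j \<le> B" using B unfolding z' Re_complex_of_real by linarith
      hence "v j + real k \<le> a j * B" using a[OF j] by (simp add: field_simps)
      hence "k \<le> M j" using M[of j] by linarith
      thus ?thesis using j z' by blast
    qed
    hence "{z \<in> L \<union> P. \<bar>Re z\<bar> \<le> B} \<subseteq> (\<lambda>k. - of_nat k) ` {..N} \<union> (\<Union>j<n. (\<lambda>k. of_real ((v j + real k) / a j)) ` {..M j})"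
      by blast
    thus ?thesis by (rule finite_subset) auto
  qed
  have op: "open (- (L \<union> P))"
    by (rule open_Compl[OF closed_if_locally_finite_Re[OF fin]])
  have holF: "integrand holomorphic_on - (L \<union> P)"
  proof -
    have "R holomorphic_on - (L \<union> P)"
      unfolding R_def by (rule Gamma_ratio_prod_holomorphic) (auto simp: P_def)
    thus ?thesis
      unfolding integrand_def
      by (intro holomorphic_intros holomorphic_of_real_powr_minus t) (auto simp: L_def)
  qed
  have decay: "\<exists>C. \<forall>s. \<alpha> \<le> Re s \<longrightarrow> Re s \<le> \<beta> \<longrightarrow> \<bar>Im s\<bar> \<ge> 1 \<longrightarrow> norm (integrand s) \<le> C / (Im s)\<^sup>2" for \<alpha> \<beta>
  proof -
    obtain K' where K': "\<And>s. Re s \<le> \<beta> \<Longrightarrow> \<bar>Im s\<bar> \<ge> 1 \<Longrightarrow> norm (R s) \<le> K'"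
      using norm_Gamma_ratio_prod_bounded[of n a v w \<beta>] a v w unfolding R_def by blast
    show ?thesis
      using mellin_kernel_decay[of t \<beta> R K' \<alpha>, OF t K'] unfolding integrand_def by blast
  qed

  obtain J where J: "((\<lambda>\<tau>. integrand (Complex \<sigma> \<tau>) * \<i>) has_integral J) UNIV"
    using has_integral_mult_left[OF integrable_integral[OF set_lebesgue_integral_eq_integral(1)[OF integrable_line(1)]], of \<i>] by blast
  have unique: "I = J" if "fox_contour 1 n us ls c" "((\<lambda>\<tau>. integrand (c \<tau>) * vector_derivative c (at \<tau>)) has_integral I) UNIV" for c I
  proof -
    from that(1) obtain \<gamma> where \<gamma>: "upward_contour \<gamma> c" and LP: "\<forall>z\<in>L. left_of_contour c z" "\<forall>z\<in>P. right_of_contour c z"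
      unfolding contour by blast
    show ?thesis
      by (rule vertical_line_integral_eq_contour[OF \<gamma> holF op _ fin _ _ decay that(2) J]) (use ReL ReP LP in auto)
  qed
  have ex: "fox_contour 1 n us ls (Complex \<sigma>)"
    unfolding contour using upward_contour_vertical_line ReL ReP left_of_vertical_line right_of_vertical_line by blast

  have adm: "fox_admissible 1 n us ls"
  proof -
    \<comment> \<open>The admissibility condition for the lower pair (0, 1) and the upper pair (1 -
      v, a): the left side is nonnegative and the right side negative.\<close>
    have "complex_of_real (a j) * of_nat l \<noteq> - of_real (v j) - of_nat l'" if "j < n" for j l l'
    proof
      assume "complex_of_real (a j) * of_nat l = - of_real (v j) - of_nat l'"
      hence "complex_of_real (a j * real l) = of_real (- v j - real l')" by simp
      hence "a j * real l = - v j - real l'" by (simp only: of_real_eq_iff)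
      moreover have "0 \<le> a j * real l" using a[OF that] by simp
      ultimately show False using v[OF that] by linarith
    qed
    thus ?thesis using a unfolding fox_admissible_def by (auto simp: us_def ls_def)
  qed
  have chi: "fox_chi 1 n us ls = 1"
  proof -
    have "(\<Sum>j\<in>{1..<Suc n}. snd (ls ! j)) = (\<Sum>j<n. a j)"
      unfolding One_nat_def sum.atLeast_Suc_lessThan_Suc_shift atLeast0LessThan by (intro sum.cong) auto
    thus ?thesis by (simp add: fox_chi_def)
  qed
  have "fox_H 1 n us ls t = 1 / (2 * of_real pi * \<i>) * J"
  proof -
    have "fox_H 1 n us ls t = (THE H. \<exists>c I. fox_contour 1 n us ls c \<and>
        ((\<lambda>\<tau>. integrand (c \<tau>) * vector_derivative c (at \<tau>)) has_integral I) UNIV \<and> H = 1 / (2 * of_real pi * \<i>) * I)"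
      unfolding fox_H_def Xi using adm chi t by (simp only: zero_less_one simp_thms if_True)
    also have "(THE H. \<exists>c I. fox_contour 1 n us ls c \<and> ((\<lambda>\<tau>. integrand (c \<tau>) * vector_derivative c (at \<tau>)) has_integral I) UNIV \<and>
        H = 1 / (2 * of_real pi * \<i>) * I) = 1 / (2 * of_real pi * \<i>) * J" (is "The ?P = ?H")
    \<comment> \<open>The vertical line is the witness, and \<open>unique\<close> handles every
      other contour.\<close>
    proof (rule the_equality)
      show "\<exists>c I. fox_contour 1 n us ls c \<and> ((\<lambda>\<tau>. integrand (c \<tau>) * vector_derivative c (at \<tau>)) has_integral I) UNIV \<and>
        1 / (2 * of_real pi * \<i>) * J = 1 / (2 * of_real pi * \<i>) * I"
        using ex J by (intro exI[of _ "Complex \<sigma>"] exI[of _ J]) (simp add: vertical_line_vector_derivative)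
    
      fix H assume "?P H"
      thus "H = ?H" using unique by blast
    qed
    finally show ?thesis .
  qed
  moreover have "J / (2 * of_real pi * \<i>) =
      of_real (\<Sum>k. (- t) ^ k / fact k * (\<Prod>j<n. Gamma (v j + a j * real k) * rGamma (w j + a j * real k)))"
  proof -
    have "residue_term = (\<lambda>k. of_real ((- t) ^ k / fact k * (\<Prod>j<n. Gamma (v j + a j * real k) * rGamma (w j + a j * real k))))"
    proof
      fix k
      have "R (- of_nat k) = of_real (\<Prod>j<n. Gamma (v j + a j * real k) * rGamma (w j + a j * real k))"
        unfolding R_def by (rule Gamma_ratio_prod_minus_of_nat)
      thus "residue_term k = of_real ((- t) ^ k / fact k * (\<Prod>j<n. Gamma (v j + a j * real k) * rGamma (w j + a j * real k)))"
        by (simp only: residue_term_def of_real_mult)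
    qed
    with vertical_line_integral_sums[OF J]
    have *: "(\<lambda>k. complex_of_real ((- t) ^ k / fact k * (\<Prod>j<n. Gamma (v j + a j * real k) * rGamma (w j + a j * real k))))
       sums (J / (2 * of_real pi * \<i>))" by simp
    show ?thesis
      using sums_unique[OF *] suminf_of_real[OF iffD1[OF summable_complex_of_real sums_summable[OF *]], where 'a = complex]
      by (simp only:)
  qed
  \<comment> \<open>Both lists have the same second components, so the defining condition of
    \<open>wright_W\<close> reads 0 > -1.\<close>
  moreover have "wright_W (map (\<lambda>j. (of_real (v j), a j)) [0..<n]) (map (\<lambda>j. (of_real (w j), a j)) [0..<n]) (- t) = fox_H 1 n us ls t"
    by (simp add: wright_W_def us_def ls_def o_def)
  ultimately show ?thesis by simp
qed

theorem corollary6p1: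
  fixes p' :: nat and a v w :: "nat \<Rightarrow> real"
  assumes "\<And>j. j \<in> {1..p'} \<Longrightarrow> a j > 0"
    and "\<And>j. j \<in> {1..p'} \<Longrightarrow> v j > 0"
    and "\<And>j. j \<in> {1..p'} \<Longrightarrow> w j \<ge> v j + 1"
    and "\<And>j (l::nat) (l'::nat). j \<in> {1..p'} \<Longrightarrow> a j * real l \<noteq> - v j - real l'"
  shows "\<forall>t>0.
    wright_W (map (\<lambda>j. (complex_of_real (v j), a j)) [1..<p' + 1])
             (map (\<lambda>j. (complex_of_real (w j), a j)) [1..<p' + 1]) (- t) \<in> \<real> \<and>
    Re (wright_W (map (\<lambda>j. (complex_of_real (v j), a j)) [1..<p' + 1])
                 (map (\<lambda>j. (complex_of_real (w j), a j)) [1..<p' + 1]) (- t)) > 0"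
proof (intro allI impI)
  fix t :: real assume t: "t > 0"
  define a' v' w' where "a' = (\<lambda>j. a (Suc j))" and "v' = (\<lambda>j. v (Suc j))" and "w' = (\<lambda>j. w (Suc j))"
  have pos: "0 < a' j" "0 < v' j" "v' j < w' j" if "j < p'" for j
    using assms(1-3)[of "Suc j"] that by (auto simp: a'_def v'_def w'_def)
  have shift: "map f [1..<p' + 1] = map (\<lambda>j. f (Suc j)) [0..<p']" for f :: "nat \<Rightarrow> complex \<times> real"
  proof -
    have "[1..<p' + 1] = map Suc [0..<p']" by (simp add: map_Suc_upt del: upt_Suc)
    thus ?thesis by (simp only: map_map o_def)
  qed
  define S where "S = (\<lambda>y. \<Sum>k. (- y) ^ k / fact k * (\<Prod>j<p'. Gamma (v' j + a' j * real k) * rGamma (w' j + a' j * real k)))"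
  \<comment> \<open>Taken with Y = t; the bound is then evaluated at the right end point y =
    t.\<close>
  have "\<exists>\<delta>>0. \<forall>y. 0 \<le> y \<longrightarrow> y \<le> t \<longrightarrow> \<delta> \<le> S y"
    unfolding S_def by (rule exponential_series_prod_Gamma_ratio_pos[OF pos less_imp_le[OF t]])
  then obtain \<delta> where "0 < \<delta>" "\<forall>y. 0 \<le> y \<longrightarrow> y \<le> t \<longrightarrow> \<delta> \<le> S y" by blast
  moreover from this have "\<delta> \<le> S t" using t by simp
  ultimately have pos_sum: "0 < S t" by linarith
  have series: "wright_W (map (\<lambda>j. (complex_of_real (v j), a j)) [1..<p' + 1])
             (map (\<lambda>j. (complex_of_real (w j), a j)) [1..<p' + 1]) (- t) =
      of_real (S t)"
    unfolding shift using wright_W_eq_series[OF pos(1,2) less_imp_le[OF pos(3)] t] unfolding S_def a'_def v'_def w'_def .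
  show "wright_W (map (\<lambda>j. (complex_of_real (v j), a j)) [1..<p' + 1])
             (map (\<lambda>j. (complex_of_real (w j), a j)) [1..<p' + 1]) (- t) \<in> \<real> \<and>
    Re (wright_W (map (\<lambda>j. (complex_of_real (v j), a j)) [1..<p' + 1])
                 (map (\<lambda>j. (complex_of_real (w j), a j)) [1..<p' + 1]) (- t)) > 0"
    unfolding series using pos_sum by (simp only: Re_complex_of_real Reals_of_real simp_thms)
qed

end
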